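(* Let $n,N\ge 1$ be integers, let $a_\gamma\in\mathbb{R}$ ($0\le|\gamma|\le N-1$) be given with $a_0=1$, and let $n_0$ be the smallest integer with $n_0>n/2$. Suppose that $\mathcal{H}:\mathbb{R}^n\to\mathbb{R}$ is differentiable up to order $n_0$ and satisfies the decay condition: there exist $K>N+n$ and constants $C_\beta>0$ such that $$|\partial^\beta \mathcal{H}(x)|\le C_\beta(1+|x|)^{-K},\qquad x\in\mathbb{R}^n,\ 0\le|\beta|\le n_0 ,$$ and the conditions $$\int_{\mathbb{R}^n}\mathcal{H}(x)\,dx=1,\qquad \sum_{\alpha\le\beta}\frac{a_{\beta-\alpha}}{\alpha!}\int_{\mathbb{R}^n}x^\alpha\mathcal{H}(x)\,dx=0\quad\text{for all }\beta\text{ with }1\le|\beta|\le N-1 .$$ Then there is a constant $c$ such that for any $\varepsilon>0$ there exists $\mathcal{D}>0$ such that, for all $h>0$, all $u\in W^N_\infty(\mathbb{R}^n)\cap C^N(\mathbb{R}^n)$ and all $x\in\mathbb{R}^n$, $$|Mu(x)-u(x)|\le \varepsilon\sum_{|\beta|=0}^{N-1}(h\sqrt{\mathcal{D}})^{|\beta|}|\partial^\beta u(x)|+c\,(h\sqrt{\mathcal{D}})^N\|\nabla_N u\|_{L_\infty},$$ where $Mu$ is the Hermite quasi-interpolant of $u$ with parameters $h,\mathcal{D}$ (defined in the context). The constant $c$ does not depend on $h$, $u$ and $\mathcal{D}$.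
   Context: Greek letters $\alpha,\beta,\gamma$ denote multi-indices in $\mathbb{Z}_{\ge0}^n$; $\alpha\le\beta$ is meant componentwise. For $h>0$, $\mathcal{D}>0$ the Hermite quasi-interpolant is $$Mu(x)=\mathcal{D}^{-n/2}\sum_{m\in\mathbb{Z}^n}\Big(\sum_{|\gamma|=0}^{N-1}(-h\sqrt{\mathcal{D}})^{|\gamma|}a_\gamma\,\partial^\gamma u(hm)\Big)\mathcal{H}\Big(\frac{x-hm}{h\sqrt{\mathcal{D}}}\Big).$$ $W^N_\infty(\mathbb{R}^n)$ is the Sobolev space of functions whose derivatives up to order $N$ are in $L_\infty(\mathbb{R}^n)$. $\nabla_N u$ is the vector of all partial derivatives of $u$ of order $N$, and $\|\nabla_N u\|_{L_\infty}=\sum_{|\beta|=N}\|\partial^\beta u\|_{L_\infty(\mathbb{R}^n)}$. *)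

theory Defs
  imports "HOL-Analysis.Analysis" "HOL-Probability.Essential_Supremum"
begin

section \<open>Multi-indices\<close>

text \<open>Multi-indices are vectors of type \<open>nat ^ 'n\<close>; the library order on vectors is the
  componentwise one, and subtraction is componentwise.\<close>

definition mi_deg :: "nat ^ 'n \<Rightarrow> nat"
  where "mi_deg \<beta> = (\<Sum>i\<in>UNIV. \<beta> $ i)"

definition mi_fact :: "nat ^ 'n \<Rightarrow> real"
  where "mi_fact \<beta> = (\<Prod>i\<in>UNIV. fact (\<beta> $ i))"

definition mi_power :: "real ^ 'n \<Rightarrow> nat ^ 'n \<Rightarrow> real"
  where "mi_power x \<beta> = (\<Prod>i\<in>UNIV. (x $ i) ^ (\<beta> $ i))"

lemma finite_mi_le: "finite {\<alpha> :: nat ^ 'n. \<alpha> \<le> \<beta>}"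
proof -
  have "{\<alpha> :: nat ^ 'n. \<alpha> \<le> \<beta>} \<subseteq> vec_lambda ` (PiE UNIV (\<lambda>i. {..\<beta> $ i}))"
  proof
    fix \<alpha> :: "nat ^ 'n" assume "\<alpha> \<in> {\<alpha>. \<alpha> \<le> \<beta>}"
    then have "vec_nth \<alpha> \<in> PiE UNIV (\<lambda>i. {..\<beta> $ i})"
      by (auto simp: less_eq_vec_def)
    then show "\<alpha> \<in> vec_lambda ` (PiE UNIV (\<lambda>i. {..\<beta> $ i}))"
      by (metis image_eqI vec_nth_inverse)
  qed
  then show ?thesis
    by (rule finite_subset) (intro finite_imageI finite_PiE, auto)
qed

lemma finite_mi_deg_le: "finite {\<alpha> :: nat ^ 'n. mi_deg \<alpha> \<le> k}"
proof -
  have "\<alpha> $ i \<le> mi_deg \<alpha>" for \<alpha> :: "nat ^ 'n" and i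
    unfolding mi_deg_def by (rule member_le_sum) auto
  then have "{\<alpha> :: nat ^ 'n. mi_deg \<alpha> \<le> k} \<subseteq> {\<alpha>. \<alpha> \<le> (\<chi> i. k)}"
    by (auto simp: less_eq_vec_def intro: order_trans)
  then show ?thesis
    using finite_mi_le finite_subset by blast
qed

section \<open>Partial derivatives and differentiability classes\<close>

definition partial :: "'n::finite \<Rightarrow> (real ^ 'n \<Rightarrow> real) \<Rightarrow> real ^ 'n \<Rightarrow> real"
  where "partial i f x = deriv (\<lambda>t. f (x + t *\<^sub>R axis i 1)) 0"

abbreviation partials :: "'n::finite list \<Rightarrow> (real ^ 'n \<Rightarrow> real) \<Rightarrow> real ^ 'n \<Rightarrow> real"
  where "partials is f \<equiv> foldr partial is f"

text \<open>The index type carries no order, so the order in which the \<open>\<beta> $ i\<close> differentiations with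
  respect to the \<open>i\<close>-th variable are carried out is left to choice. For functions that are
  \<open>mi_deg \<beta>\<close> times differentiable (see below) the result does not depend on it.\<close>

definition mi_list :: "nat ^ 'n::finite \<Rightarrow> 'n list"
  where "mi_list \<beta> = (SOME is. \<forall>i. count_list is i = \<beta> $ i)"

definition mi_deriv :: "nat ^ 'n::finite \<Rightarrow> (real ^ 'n \<Rightarrow> real) \<Rightarrow> real ^ 'n \<Rightarrow> real"
  where "mi_deriv \<beta> f = partials (mi_list \<beta>) f"

lemma count_list_mi_list: "count_list (mi_list \<beta>) i = \<beta> $ i"
proof -
  obtain xs where xs: "mset xs = Abs_multiset (vec_nth \<beta>)"
    using ex_mset by blast
  have "count_list xs i = \<beta> $ i" for i
    by (metis (no_types, lifting) count_mset xs count_Abs_multiset finite_code)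
  then have "\<exists>is. \<forall>i. count_list is i = \<beta> $ i"
    by blast
  from someI_ex[OF this] show ?thesis
    by (simp add: mi_list_def)
qed

text \<open>\<open>k\<close> times (totally) differentiable on the whole space: every partial derivative of order
  less than \<open>k\<close> is differentiable. No continuity of the derivatives of order \<open>k\<close> is required.\<close>

definition times_differentiable :: "nat \<Rightarrow> (real ^ 'n::finite \<Rightarrow> real) \<Rightarrow> bool"
  where "times_differentiable k f \<longleftrightarrow>
    (\<forall>is x. length is < k \<longrightarrow> partials is f differentiable at x)"

definition C_class :: "nat \<Rightarrow> (real ^ 'n::finite \<Rightarrow> real) set"
  where "C_class k = {f. times_differentiable k f \<and>
    (\<forall>is. length is \<le> k \<longrightarrow> continuous_on UNIV (partials is f))}"

section \<open>Lebesgue and Sobolev spaces\<close>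

definition Linf_space :: "(real ^ 'n::finite \<Rightarrow> real) set"
  where "Linf_space = {f \<in> borel_measurable lebesgue. esssup lebesgue (\<lambda>x. ereal \<bar>f x\<bar>) < \<infinity>}"

definition Linf_norm :: "(real ^ 'n::finite \<Rightarrow> real) \<Rightarrow> real"
  where "Linf_norm f = real_of_ereal (esssup lebesgue (\<lambda>x. ereal \<bar>f x\<bar>))"

definition test_functions :: "(real ^ 'n::finite \<Rightarrow> real) set"
  where "test_functions = {\<phi>. (\<forall>k. \<phi> \<in> C_class k) \<and> compact (closure {x. \<phi> x \<noteq> 0})}"

text \<open>Only used for \<open>u\<close> and \<open>v\<close> in \<open>Linf_space\<close>, where both integrals converge.\<close>

definition weak_deriv ::
    "nat ^ 'n::finite \<Rightarrow> (real ^ 'n \<Rightarrow> real) \<Rightarrow> (real ^ 'n \<Rightarrow> real) \<Rightarrow> bool"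
  where "weak_deriv \<beta> u v \<longleftrightarrow> (\<forall>\<phi>\<in>test_functions.
    (LINT x|lebesgue. u x * mi_deriv \<beta> \<phi> x) = (-1) ^ mi_deg \<beta> * (LINT x|lebesgue. v x * \<phi> x))"

definition sobolev_inf :: "nat \<Rightarrow> (real ^ 'n::finite \<Rightarrow> real) set"
  where "sobolev_inf N = {u \<in> Linf_space.
    \<forall>\<beta>. mi_deg \<beta> \<le> N \<longrightarrow> (\<exists>v\<in>Linf_space. weak_deriv \<beta> u v)}"

text \<open>The norm of the vector of all derivatives of order \<open>N\<close>; it is applied to \<open>u\<close> in
  \<open>C_class N\<close>, so classical derivatives are used.\<close>

definition grad_norm :: "nat \<Rightarrow> (real ^ 'n::finite \<Rightarrow> real) \<Rightarrow> real"
  where "grad_norm N u = (\<Sum>\<beta> | mi_deg \<beta> = N. Linf_norm (mi_deriv \<beta> u))"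

section \<open>The Hermite quasi-interpolant\<close>

definition lattice_pt :: "real \<Rightarrow> int ^ 'n \<Rightarrow> real ^ 'n"
  where "lattice_pt h m = (\<chi> i. h * of_int (m $ i))"

definition quasi_interp ::
    "nat \<Rightarrow> (nat ^ 'n \<Rightarrow> real) \<Rightarrow> (real ^ 'n \<Rightarrow> real) \<Rightarrow> real \<Rightarrow> real \<Rightarrow>
     (real ^ 'n::finite \<Rightarrow> real) \<Rightarrow> real ^ 'n \<Rightarrow> real"
  where "quasi_interp N a H D h u x =
    D powr (- real CARD('n) / 2) *
    (\<Sum>\<^sub>\<infinity>m\<in>UNIV.
      (\<Sum>\<gamma> | mi_deg \<gamma> \<le> N - 1.
        (- h * sqrt D) ^ mi_deg \<gamma> * a \<gamma> * mi_deriv \<gamma> u (lattice_pt h m)) *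
      H ((x - lattice_pt h m) /\<^sub>R (h * sqrt D)))"

end

theory Submission
  imports Defs
begin

text \<open>
  Write \<open>s = h * sqrt D\<close>, \<open>\<delta> = 1 / sqrt D\<close> and \<open>y\<^sub>m = (x - h m) / s\<close>. In these variables
  \<open>y\<^sub>m = x / s - \<delta> m\<close> runs through a shifted lattice of mesh \<open>\<delta>\<close>, and the factor \<open>D\<close> to the power
  \<open>- n / 2\<close> in front of the quasi-interpolant is \<open>\<delta> ^ n\<close>, the volume of a lattice cell.

  Expanding each \<open>\<partial>\<^sup>\<gamma> u (h m)\<close> by Taylor's formula at \<open>x\<close> up to total order \<open>N - 1\<close> and sorting by
  \<open>\<beta> = \<gamma> + \<alpha>\<close> (lemma \<open>sum_taylor_eq_sum_moment_poly\<close>) turns the polynomial part of \<open>M u x\<close> into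
  \<open>\<Sum>\<^sub>\<beta> (- s) ^ |\<beta>| * \<partial>\<^sup>\<beta> u x * R\<^sub>\<beta>\<close>, where \<open>R\<^sub>\<beta>\<close> is the Riemann sum, on that lattice, of
  \<open>Q\<^sub>\<beta> y * H y\<close> with \<open>Q\<^sub>\<beta> y = \<Sum>\<^bsub>\<alpha> \<le> \<beta>\<^esub> a (\<beta> - \<alpha>) / \<alpha>! * y\<^sup>\<alpha>\<close> (\<open>moment_poly\<close>). The moment conditions say
  precisely that \<open>Q\<^sub>\<beta> * H\<close> has integral \<open>1\<close> for \<open>\<beta> = 0\<close> and \<open>0\<close> for \<open>1 \<le> |\<beta>| \<le> N - 1\<close>.
  Riemann sums of a continuous function that decays faster than \<open>|y|\<close> to the power \<open>- n\<close> converge to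
  its integral as \<open>\<delta>\<close> tends to \<open>0\<close>, uniformly in the shift of the lattice
  (lemma \<open>lattice_riemann_sums_uniform\<close>). Hence for large \<open>D\<close> the polynomial part differs from \<open>u x\<close> by at most \<open>\<epsilon> * (\<Sum>\<^sub>\<beta> s ^ |\<beta>| * |\<partial>\<^sup>\<beta> u x|)\<close>.

  The Taylor remainders contribute at most \<open>s ^ N * \<parallel>\<nabla>\<^sub>N u\<parallel>\<close> times a Riemann sum of
  \<open>|y| ^ (N - |\<gamma>|) * |H y|\<close>, which is at most a constant times \<open>1 + |y|\<close> to the power \<open>N - K\<close>; as
  \<open>K - N > n\<close>, the same convergence result bounds these sums, for all large \<open>D\<close>, by a constant that
  depends on neither \<open>h\<close>, \<open>u\<close>, \<open>x\<close> nor \<open>D\<close>. Lemma \<open>quasi_interp_error_le\<close> combines both parts.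

  The remainder estimate needs pointwise bounds of the classical derivatives of order \<open>N\<close>, whereas
  membership in the Sobolev space speaks of weak derivatives. Integration by parts against smooth
  bump functions identifies the two, and continuity turns the essential bound into a pointwise one
  (lemma \<open>sobolev_C_class_deriv_bounded\<close>).
\<close>

section \<open>Partial derivatives along lines and their symmetry\<close>

lemma has_derivative_imp_partial:
  assumes "(f has_derivative f') (at x)"
  shows "partial i f x = f' (axis i 1)"
proof -
  have lin: "linear f'"
    using assms has_derivative_linear by blast
  have "((\<lambda>t::real. x + t *\<^sub>R axis i 1) has_derivative (\<lambda>t. t *\<^sub>R axis i 1)) (at 0)"
    by (auto intro!: derivative_eq_intros)
  moreover have "(f has_derivative f') (at (x + 0 *\<^sub>R axis i 1))"
    using assms by simp
  ultimately have "((\<lambda>t. f (x + t *\<^sub>R axis i 1)) has_derivative (\<lambda>t. f' (t *\<^sub>R axis i 1))) (at 0)"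
    by (rule has_derivative_compose)
  then have "((\<lambda>t. f (x + t *\<^sub>R axis i 1)) has_real_derivative f' (axis i 1)) (at 0)"
    by (simp add: has_field_derivative_def linear_scale[OF lin] mult.commute[of _ "f' _"] fun_eq_iff)
  then show ?thesis
    by (simp add: partial_def DERIV_imp_deriv)
qed

lemma has_derivative_partial:
  assumes "f differentiable at x"
  shows "(f has_derivative (\<lambda>v. \<Sum>i\<in>UNIV. v $ i * partial i f x)) (at x)"
proof -
  obtain f' where f': "(f has_derivative f') (at x)"
    using assms differentiable_def by blast
  have lin: "linear f'"
    using f' has_derivative_linear by blast
  have "f' v = (\<Sum>i\<in>UNIV. v $ i * partial i f x)" for v
  proof -
    have "f' v = f' (\<Sum>i\<in>UNIV. v $ i *\<^sub>R axis i 1)"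
      using basis_expansion[of v] by (simp add: scalar_mult_eq_scaleR)
    also have "\<dots> = (\<Sum>i\<in>UNIV. v $ i * partial i f x)"
      by (simp add: linear_sum[OF lin] linear_scale[OF lin] has_derivative_imp_partial[OF f'])
    finally show ?thesis .
  qed
  then have "f' = (\<lambda>v. \<Sum>i\<in>UNIV. v $ i * partial i f x)"
    by blast
  with f' show ?thesis by simp
qed

lemma has_real_derivative_line:
  assumes "f differentiable at (x + t *\<^sub>R v)"
  shows "((\<lambda>s. f (x + s *\<^sub>R v)) has_real_derivative
            (\<Sum>i\<in>UNIV. v $ i * partial i f (x + t *\<^sub>R v))) (at t)"
proof -
  have "((\<lambda>s::real. x + s *\<^sub>R v) has_derivative (\<lambda>s. s *\<^sub>R v)) (at t)"
    by (auto intro!: derivative_eq_intros)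
  from has_derivative_compose[OF this has_derivative_partial[OF assms]]
  show ?thesis
    unfolding has_field_derivative_def
    by (rule has_derivative_eq_rhs) (simp add: fun_eq_iff sum_distrib_left sum_distrib_right mult_ac)
qed

lemma has_real_derivative_axis:
  assumes "f differentiable at (x + t *\<^sub>R axis i 1)"
  shows "((\<lambda>s. f (x + s *\<^sub>R axis i 1)) has_real_derivative partial i f (x + t *\<^sub>R axis i 1)) (at t)"
proof -
  have "(\<Sum>j\<in>UNIV. axis i 1 $ j * partial j f y) = partial i f y" for y
    by (simp add: axis_def of_bool_def[symmetric] if_distrib[of "\<lambda>c. c * _"] cong: if_cong)
  with has_real_derivative_line[OF assms] show ?thesis by simp
qed

text \<open>The mean value theorem, applied first in direction \<open>i\<close> and then in direction \<open>j\<close>,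
  expresses the second difference of \<open>f\<close> through the mixed derivative. The second difference
  itself is symmetric in \<open>i\<close> and \<open>j\<close>, which is what makes the mixed derivatives agree.\<close>

lemma second_difference_mvt:
  assumes f: "\<And>y. f differentiable at y" and pf: "\<And>y. partial i f differentiable at y"
    and s: "s > 0"
  obtains a b where "0 < a" "a < s" "0 < b" "b < s"
    "f (x + s *\<^sub>R axis i 1 + s *\<^sub>R axis j 1) - f (x + s *\<^sub>R axis i 1) - f (x + s *\<^sub>R axis j 1) + f x
      = s * s * partial j (partial i f) (x + a *\<^sub>R axis i 1 + b *\<^sub>R axis j 1)"
proof -
  define g where "g t = f (x + s *\<^sub>R axis j 1 + t *\<^sub>R axis i 1) - f (x + t *\<^sub>R axis i 1)" for t
  have "DERIV g t :> partial i f (x + s *\<^sub>R axis j 1 + t *\<^sub>R axis i 1) - partial i f (x + t *\<^sub>R axis i 1)" for t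
    unfolding g_def by (intro DERIV_diff has_real_derivative_axis f)
  from MVT2[OF s this] obtain a where a: "0 < a" "a < s"
    and ga: "g s - g 0 = s * (partial i f (x + s *\<^sub>R axis j 1 + a *\<^sub>R axis i 1) - partial i f (x + a *\<^sub>R axis i 1))"
    by auto
  have "DERIV (\<lambda>t. partial i f (x + a *\<^sub>R axis i 1 + t *\<^sub>R axis j 1)) t :>
          partial j (partial i f) (x + a *\<^sub>R axis i 1 + t *\<^sub>R axis j 1)" for t
    by (intro has_real_derivative_axis pf)
  from MVT2[OF s this] obtain b where b: "0 < b" "b < s"
    and gb: "partial i f (x + a *\<^sub>R axis i 1 + s *\<^sub>R axis j 1) - partial i f (x + a *\<^sub>R axis i 1)
      = s * partial j (partial i f) (x + a *\<^sub>R axis i 1 + b *\<^sub>R axis j 1)"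
    by auto
  show ?thesis
    by (rule that[OF a b]) (use ga gb in \<open>simp add: g_def algebra_simps\<close>)
qed

lemma partial_commute:
  assumes f: "\<And>y. f differentiable at y" and pf: "\<And>i y. partial i f differentiable at y"
    and cont: "\<And>i j. continuous_on UNIV (partial i (partial j f))"
  shows "partial i (partial j f) = partial j (partial i f)"
proof
  fix x
  have "\<exists>p q. norm (p - x) \<le> 2 * inverse (real (Suc k)) \<and> norm (q - x) \<le> 2 * inverse (real (Suc k)) \<and>
     partial j (partial i f) p = partial i (partial j f) q" for k
  proof -
    define s where "s = inverse (real (Suc k))"
    have s: "s > 0" by (simp add: s_def)
    have close: "norm (x + c *\<^sub>R axis l 1 + d *\<^sub>R axis m 1 - x) \<le> 2 * s"
      if "0 < c" "c < s" "0 < d" "d < s" for c d and l m :: 'a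
    proof -
      have "norm (x + c *\<^sub>R axis l 1 + d *\<^sub>R axis m 1 - x) \<le> norm (c *\<^sub>R axis l (1::real)) + norm (d *\<^sub>R axis m (1::real))"
        using norm_triangle_ineq[of "c *\<^sub>R axis l (1::real)" "d *\<^sub>R axis m (1::real)"] by (simp add: algebra_simps)
      also have "\<dots> \<le> 2 * s" using that by simp
      finally show ?thesis .
    qed
    obtain a b where ab: "0 < a" "a < s" "0 < b" "b < s" and
     1: "f (x + s *\<^sub>R axis i 1 + s *\<^sub>R axis j 1) - f (x + s *\<^sub>R axis i 1) - f (x + s *\<^sub>R axis j 1) + f x
      = s * s * partial j (partial i f) (x + a *\<^sub>R axis i 1 + b *\<^sub>R axis j 1)"
      using second_difference_mvt[OF f pf s] by blast
    obtain c d where cd: "0 < c" "c < s" "0 < d" "d < s" and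
     2: "f (x + s *\<^sub>R axis j 1 + s *\<^sub>R axis i 1) - f (x + s *\<^sub>R axis j 1) - f (x + s *\<^sub>R axis i 1) + f x
      = s * s * partial i (partial j f) (x + c *\<^sub>R axis j 1 + d *\<^sub>R axis i 1)"
      using second_difference_mvt[OF f pf s] by blast
    have "s * s * partial j (partial i f) (x + a *\<^sub>R axis i 1 + b *\<^sub>R axis j 1)
        = s * s * partial i (partial j f) (x + c *\<^sub>R axis j 1 + d *\<^sub>R axis i 1)"
      unfolding 1[symmetric] 2[symmetric] by (simp add: algebra_simps)
    then have "partial j (partial i f) (x + a *\<^sub>R axis i 1 + b *\<^sub>R axis j 1)
        = partial i (partial j f) (x + c *\<^sub>R axis j 1 + d *\<^sub>R axis i 1)"
      using s by simp
    then show ?thesis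
      using close[OF ab] close[OF cd] unfolding s_def by blast
  qed
  then obtain p q where p: "\<And>k. norm (p k - x) \<le> 2 * inverse (real (Suc k))"
    and q: "\<And>k. norm (q k - x) \<le> 2 * inverse (real (Suc k))"
    and eq: "\<And>k. partial j (partial i f) (p k) = partial i (partial j f) (q k)"
    by metis
  have lim: "r \<longlonglongrightarrow> x" if "\<And>k. norm (r k - x) \<le> 2 * inverse (real (Suc k))" for r :: "nat \<Rightarrow> real^'a"
  proof -
    have "(\<lambda>k. r k - x) \<longlonglongrightarrow> 0"
      using that tendsto_mult_right_zero[OF LIMSEQ_inverse_real_of_nat]
      by (rule Lim_null_comparison[OF always_eventually, rule_format])
    then show ?thesis by (simp add: LIM_zero_iff)
  qed
  have "isCont (partial j (partial i f)) x" "isCont (partial i (partial j f)) x"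
    using cont by (auto simp: continuous_on_eq_continuous_at)
  then have "(\<lambda>k. partial j (partial i f) (p k)) \<longlonglongrightarrow> partial j (partial i f) x"
    "(\<lambda>k. partial i (partial j f) (q k)) \<longlonglongrightarrow> partial i (partial j f) x"
    using lim[OF p] lim[OF q] by (auto intro: isCont_tendsto_compose)
  then show "partial i (partial j f) x = partial j (partial i f) x"
    unfolding eq using LIMSEQ_unique by blast
qed

section \<open>Multi-index derivatives of functions of class \<open>C\<^sup>k\<close>\<close>

lemma C_class_differentiable:
  "f \<in> C_class k \<Longrightarrow> length is < k \<Longrightarrow> partials is f differentiable at x"
  by (auto simp: C_class_def times_differentiable_def)

lemma C_class_continuous:
  "f \<in> C_class k \<Longrightarrow> length is \<le> k \<Longrightarrow> continuous_on UNIV (partials is f)"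
  by (auto simp: C_class_def)

lemma C_class_partials:
  assumes "f \<in> C_class k" "length js \<le> k"
  shows "partials js f \<in> C_class (k - length js)"
proof -
  have eq: "partials is (partials js f) = partials (is @ js) f" for "is"
    by simp
  show ?thesis
    unfolding C_class_def times_differentiable_def mem_Collect_eq eq
  proof (intro conjI allI impI)
    show "partials (is @ js) f differentiable at x" if "length is < k - length js" for "is" x
      using that by (intro C_class_differentiable[OF assms(1)]) simp
    show "continuous_on UNIV (partials (is @ js) f)" if "length is \<le> k - length js" for "is"
      using that assms(2) by (intro C_class_continuous[OF assms(1)]) simp
  qed
qed

lemma C_class_partial_commute:
  assumes "f \<in> C_class k" "2 \<le> k"
  shows "partial i (partial j f) = partial j (partial i f)"
proof (rule partial_commute)
  show "f differentiable at y" for y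
    using C_class_differentiable[OF assms(1), of "[]"] assms(2) by simp
  show "partial i f differentiable at y" for i y
    using C_class_differentiable[OF assms(1), of "[i]"] assms(2) by simp
  show "continuous_on UNIV (partial i (partial j f))" for i j
    using C_class_continuous[OF assms(1), of "[i, j]"] assms(2) by simp
qed

lemma partials_rotate:
  assumes "f \<in> C_class k" "Suc (length xs) \<le> k"
  shows "partials (i # xs) f = partials (xs @ [i]) f"
  using assms(2)
proof (induction xs)
  case (Cons x xs)
  have "partials xs f \<in> C_class (k - length xs)"
    using Cons.prems by (intro C_class_partials assms) auto
  then have "partials (i # x # xs) f = partial x (partials (i # xs) f)"
    using Cons.prems by (simp add: C_class_partial_commute[of _ "k - length xs" i x])
  also have "\<dots> = partial x (partials (xs @ [i]) f)"
    using Cons by (metis Suc_leD length_Cons)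
  finally show ?case by simp
qed simp

text \<open>A permutation is undone by moving one differentiation at a time to its place; lemma
  \<open>partials_rotate\<close> does so by repeated exchange of two adjacent differentiations. This makes
  \<open>mi_deriv\<close> independent of the order chosen in its definition.\<close>

lemma partials_cong_mset:
  assumes "f \<in> C_class k" "length is \<le> k" "mset is = mset js"
  shows "partials is f = partials js f"
  using assms(2,3)
proof (induction "is" arbitrary: js)
  case (Cons i "is")
  then have "i \<in> set js"
    by (metis list.set_intros(1) set_mset_mset)
  then obtain as bs where js: "js = as @ i # bs"
    using split_list by metis
  have len: "length is = length as + length bs"
    using Cons.prems(2) js by (metis add_mset_remove_trivial mset.simps(2) mset_append size_mset
        union_mset_add_mset_right length_append)
  have "partials (i # is) f = partial i (partials (as @ bs) f)"
    using Cons.IH[of "as @ bs"] Cons.prems js by simp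
  also have "\<dots> = partials (i # as) (partials bs f)"
    by simp
  also have "\<dots> = partials (as @ [i]) (partials bs f)"
    using Cons.prems(1) len
    by (intro partials_rotate[where k = "k - length bs"] C_class_partials[OF assms(1)]) auto
  finally show ?case
    by (simp add: js)
qed simp

lemma length_mi_list [simp]: "length (mi_list \<beta>) = mi_deg \<beta>"
proof -
  have "length (mi_list \<beta>) = (\<Sum>i\<in>UNIV. count_list (mi_list \<beta>) i)"
    by (rule sum_count_set[symmetric]) auto
  then show ?thesis by (simp add: mi_deg_def count_list_mi_list)
qed

lemma mi_deg_0 [simp]: "mi_deg 0 = 0"
  by (simp add: mi_deg_def)

lemma mi_deg_add: "mi_deg (\<alpha> + \<beta>) = mi_deg \<alpha> + mi_deg \<beta>"
  by (simp add: mi_deg_def sum.distrib)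

lemma mi_deg_axis [simplified, simp]: "mi_deg (axis i 1) = 1"
  by (simp add: mi_deg_def axis_def of_bool_def[symmetric])

lemma mi_deg_eq_0_iff [simp]: "mi_deg \<alpha> = 0 \<longleftrightarrow> \<alpha> = 0"
  by (auto simp: mi_deg_def vec_eq_iff)

lemma finite_mi_deg_eq [simp]: "finite {\<alpha> :: nat ^ 'n. mi_deg \<alpha> = k}"
  by (rule finite_subset[OF _ finite_mi_deg_le[of k]]) auto

lemma finite_mi_deg_less [simp]: "finite {\<alpha> :: nat ^ 'n. mi_deg \<alpha> < k}"
  by (rule finite_subset[OF _ finite_mi_deg_le[of k]]) auto

lemma mi_deriv_0 [simp]: "mi_deriv 0 f = f"
proof -
  have "mi_list (0 :: nat ^ 'a) = []"
    by (simp flip: length_0_conv)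
  then show ?thesis by (simp add: mi_deriv_def)
qed

lemma partials_eq_mi_deriv:
  assumes "f \<in> C_class k" "length is \<le> k" "\<And>i. count_list is i = \<beta> $ i"
  shows "partials is f = mi_deriv \<beta> f"
  unfolding mi_deriv_def
  by (rule partials_cong_mset[OF assms(1,2)])
     (simp add: multiset_eq_iff count_mset assms(3) count_list_mi_list)

lemma partial_mi_deriv:
  assumes "f \<in> C_class k" "mi_deg \<beta> < k"
  shows "partial i (mi_deriv \<beta> f) = mi_deriv (\<beta> + axis i 1) f"
proof -
  have "partials (i # mi_list \<beta>) f = mi_deriv (\<beta> + axis i 1) f"
    using assms by (intro partials_eq_mi_deriv[where k = k]) (auto simp: count_list_mi_list axis_def)
  then show ?thesis by (simp add: mi_deriv_def)
qed

lemma mi_deriv_differentiable: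
  "f \<in> C_class k \<Longrightarrow> mi_deg \<beta> < k \<Longrightarrow> mi_deriv \<beta> f differentiable at x"
  by (simp add: mi_deriv_def C_class_differentiable)

lemma mi_deriv_continuous:
  "f \<in> C_class k \<Longrightarrow> mi_deg \<beta> \<le> k \<Longrightarrow> continuous_on UNIV (mi_deriv \<beta> f)"
  by (simp add: mi_deriv_def C_class_continuous)

section \<open>Taylor's formula\<close>

lemma mi_fact_0 [simp]: "mi_fact 0 = 1"
  and mi_power_0 [simp]: "mi_power x 0 = 1"
  by (simp_all add: mi_fact_def mi_power_def)

lemma mi_fact_ge_1: "mi_fact \<alpha> \<ge> 1"
  unfolding mi_fact_def by (intro prod_ge_1) simp

lemma mi_fact_pos [simp]: "mi_fact \<alpha> > 0"
  using mi_fact_ge_1[of \<alpha>] by linarith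

lemma mi_power_add: "mi_power x (\<alpha> + \<beta>) = mi_power x \<alpha> * mi_power x \<beta>"
  by (simp add: mi_power_def power_add prod.distrib)

lemma mi_power_axis [simplified, simp]: "mi_power x (axis i 1) = x $ i"
proof -
  have "mi_power x (axis i 1) = (\<Prod>j\<in>UNIV. if j = i then x $ j else 1)"
    unfolding mi_power_def by (intro prod.cong) (auto simp: axis_def)
  then show ?thesis by simp
qed

lemma mi_power_scaleR: "mi_power (c *\<^sub>R x) \<alpha> = c ^ mi_deg \<alpha> * mi_power x \<alpha>"
  by (simp add: mi_power_def mi_deg_def power_mult_distrib prod.distrib power_sum)

lemma abs_mi_power_le: "\<bar>mi_power x \<alpha>\<bar> \<le> norm x ^ mi_deg \<alpha>"
proof -
  have "\<bar>mi_power x \<alpha>\<bar> = (\<Prod>i\<in>UNIV. \<bar>x $ i\<bar> ^ (\<alpha> $ i))"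
    by (simp add: mi_power_def abs_prod power_abs)
  also have "\<dots> \<le> (\<Prod>i\<in>UNIV. norm x ^ (\<alpha> $ i))"
    by (intro prod_mono) (auto intro!: power_mono component_le_norm_cart)
  also have "\<dots> = norm x ^ mi_deg \<alpha>"
    by (simp add: mi_deg_def power_sum)
  finally show ?thesis .
qed

lemma mi_fact_add_axis: "mi_fact (\<alpha> + axis i 1) = real ((\<alpha> + axis i 1) $ i) * mi_fact \<alpha>"
proof -
  have "mi_fact (\<alpha> + axis i 1) = (\<Prod>j\<in>UNIV. (if j = i then real ((\<alpha> + axis i 1) $ i) else 1) * fact (\<alpha> $ j))"
    unfolding mi_fact_def by (intro prod.cong) (auto simp: axis_def)
  also have "\<dots> = real ((\<alpha> + axis i 1) $ i) * mi_fact \<alpha>"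
    by (simp add: prod.distrib mi_fact_def)
  finally show ?thesis .
qed

text \<open>Every multi-index of degree \<open>Suc j\<close> with \<open>\<beta> $ i > 0\<close> arises from exactly one of degree \<open>j\<close>
  by raising its \<open>i\<close>-th entry; the factor that vanishes at \<open>\<beta> $ i = 0\<close> allows the sum to run
  over all multi-indices of degree \<open>Suc j\<close>.\<close>

lemma sum_mi_add_axis:
  fixes G :: "nat ^ 'n::finite \<Rightarrow> real"
  assumes "\<And>\<beta>. \<beta> $ i = 0 \<Longrightarrow> G \<beta> = 0"
  shows "(\<Sum>\<alpha> | mi_deg \<alpha> = j. G (\<alpha> + axis i 1)) = (\<Sum>\<beta> | mi_deg \<beta> = Suc j. G \<beta>)"
proof -
  have "(\<Sum>\<beta> | mi_deg \<beta> = Suc j. G \<beta>) = (\<Sum>\<beta> | mi_deg \<beta> = Suc j \<and> \<beta> $ i \<noteq> 0. G \<beta>)"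
    using assms by (intro sum.mono_neutral_right) auto
  also have "\<dots> = (\<Sum>\<alpha> | mi_deg \<alpha> = j. G (\<alpha> + axis i 1))"
  proof (intro sum.reindex_bij_witness[where i = "\<lambda>\<alpha>. \<alpha> + axis i 1" and j = "\<lambda>\<beta>. \<beta> - axis i 1"])
    fix \<beta> :: "nat ^ 'n" assume b: "\<beta> \<in> {\<beta>. mi_deg \<beta> = Suc j \<and> \<beta> $ i \<noteq> 0}"
    then show *: "\<beta> - axis i 1 + axis i 1 = \<beta>"
      by (auto simp: vec_eq_iff axis_def)
    then have "mi_deg (\<beta> - axis i 1) + 1 = Suc j"
      using b mi_deg_add[of "\<beta> - axis i 1" "axis i 1"] by simp
    then show "\<beta> - axis i 1 \<in> {\<alpha>. mi_deg \<alpha> = j}" by simp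
    show "G (\<beta> - axis i 1 + axis i 1) = G \<beta>" by (simp only: *)
  next
    fix \<alpha> :: "nat ^ 'n" assume "\<alpha> \<in> {\<alpha>. mi_deg \<alpha> = j}"
    then show "\<alpha> + axis i 1 \<in> {\<beta>. mi_deg \<beta> = Suc j \<and> \<beta> $ i \<noteq> 0}"
      by (simp add: mi_deg_add)
    show "\<alpha> + axis i 1 - axis i 1 = \<alpha>"
      by simp
  qed
  finally show ?thesis by simp
qed

text \<open>Along the line \<open>x + t v\<close> the \<open>j\<close>-th derivative is given by the multinomial expansion; one more
  differentiation raises one entry of the multi-index, and the identity
  \<open>\<Sum>\<^sub>i \<beta>\<^sub>i = Suc j\<close> collects the coefficients.\<close>

lemma DERIV_multinomial_line:
  fixes f :: "real ^ 'n::finite \<Rightarrow> real" and x v :: "real ^ 'n"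
  assumes f: "f \<in> C_class k" and deg: "mi_deg \<gamma> + j < k"
  defines "\<phi> \<equiv> \<lambda>j t. \<Sum>\<alpha> | mi_deg \<alpha> = j. fact j / mi_fact \<alpha> * mi_power v \<alpha> * mi_deriv (\<gamma> + \<alpha>) f (x + t *\<^sub>R v)"
  shows "DERIV (\<phi> j) t :> \<phi> (Suc j) t"
proof -
  define G where "G i \<beta> = fact j * real (\<beta> $ i) / mi_fact \<beta> * mi_power v \<beta> * mi_deriv (\<gamma> + \<beta>) f (x + t *\<^sub>R v)"
    for i and \<beta> :: "nat ^ 'n"
  have step: "fact j / mi_fact \<alpha> * mi_power v \<alpha> *
      (\<Sum>i\<in>UNIV. v $ i * partial i (mi_deriv (\<gamma> + \<alpha>) f) (x + t *\<^sub>R v)) = (\<Sum>i\<in>UNIV. G i (\<alpha> + axis i 1))"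
    if "mi_deg \<alpha> = j" for \<alpha>
  proof -
    have "partial i (mi_deriv (\<gamma> + \<alpha>) f) = mi_deriv (\<gamma> + (\<alpha> + axis i 1)) f" for i
      using partial_mi_deriv[OF f, of "\<gamma> + \<alpha>" i] that deg by (simp add: mi_deg_add add.assoc)
    moreover have "(\<alpha> + axis i 1) $ i \<noteq> 0" for i
      by (simp add: axis_def)
    ultimately show ?thesis
      unfolding G_def mi_fact_add_axis sum_distrib_left
      by (intro sum.cong) (simp_all add: mi_power_add field_simps del: vector_add_component)
  qed
  have "DERIV (\<phi> j) t :> (\<Sum>\<alpha> | mi_deg \<alpha> = j. fact j / mi_fact \<alpha> * mi_power v \<alpha> *
      (\<Sum>i\<in>UNIV. v $ i * partial i (mi_deriv (\<gamma> + \<alpha>) f) (x + t *\<^sub>R v)))"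
    unfolding \<phi>_def using deg
    by (intro DERIV_sum DERIV_cmult has_real_derivative_line mi_deriv_differentiable[OF f]) (simp add: mi_deg_add)
  also have "(\<Sum>\<alpha> | mi_deg \<alpha> = j. fact j / mi_fact \<alpha> * mi_power v \<alpha> *
      (\<Sum>i\<in>UNIV. v $ i * partial i (mi_deriv (\<gamma> + \<alpha>) f) (x + t *\<^sub>R v)))
      = (\<Sum>\<alpha> | mi_deg \<alpha> = j. \<Sum>i\<in>UNIV. G i (\<alpha> + axis i 1))"
    by (intro sum.cong refl step) simp
  also have "\<dots> = (\<Sum>i\<in>UNIV. \<Sum>\<beta> | mi_deg \<beta> = Suc j. G i \<beta>)"
    by (subst sum.swap, intro sum.cong refl sum_mi_add_axis) (simp add: G_def)
  also have "\<dots> = (\<Sum>\<beta> | mi_deg \<beta> = Suc j. \<Sum>i\<in>UNIV. G i \<beta>)"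
    by (rule sum.swap)
  also have "\<dots> = \<phi> (Suc j) t"
    unfolding \<phi>_def
  proof (intro sum.cong refl)
    fix \<beta> :: "nat ^ 'n" assume "\<beta> \<in> {\<beta>. mi_deg \<beta> = Suc j}"
    then have "(\<Sum>i\<in>UNIV. real (\<beta> $ i)) = real (Suc j)"
      by (simp add: mi_deg_def flip: of_nat_sum)
    moreover have "(\<Sum>i\<in>UNIV. G i \<beta>) = fact j * (\<Sum>i\<in>UNIV. real (\<beta> $ i)) / mi_fact \<beta> * mi_power v \<beta> * mi_deriv (\<gamma> + \<beta>) f (x + t *\<^sub>R v)"
      unfolding G_def sum_distrib_left sum_distrib_right sum_divide_distrib ..
    ultimately show "(\<Sum>i\<in>UNIV. G i \<beta>) = fact (Suc j) / mi_fact \<beta> * mi_power v \<beta> * mi_deriv (\<gamma> + \<beta>) f (x + t *\<^sub>R v)"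
      by (simp add: mult_ac)
  qed
  finally show ?thesis .
qed

lemma taylor_mi_deriv:
  fixes f :: "real ^ 'n::finite \<Rightarrow> real"
  assumes f: "f \<in> C_class k" and \<gamma>: "mi_deg \<gamma> < k"
  obtains t where
    "mi_deriv \<gamma> f (x + v) =
       (\<Sum>\<alpha> | mi_deg \<alpha> < k - mi_deg \<gamma>. mi_power v \<alpha> / mi_fact \<alpha> * mi_deriv (\<gamma> + \<alpha>) f x) +
       (\<Sum>\<alpha> | mi_deg \<alpha> = k - mi_deg \<gamma>. mi_power v \<alpha> / mi_fact \<alpha> * mi_deriv (\<gamma> + \<alpha>) f (x + t *\<^sub>R v))"
proof -
  define \<phi> where "\<phi> j t = (\<Sum>\<alpha> | mi_deg \<alpha> = j. fact j / mi_fact \<alpha> * mi_power v \<alpha> * mi_deriv (\<gamma> + \<alpha>) f (x + t *\<^sub>R v))" for j t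
  let ?n = "k - mi_deg \<gamma>"
  have "\<forall>m t. m < ?n \<and> 0 \<le> t \<and> t \<le> 1 \<longrightarrow> DERIV (\<phi> m) t :> \<phi> (Suc m) t"
    unfolding \<phi>_def by (intro allI impI DERIV_multinomial_line[OF f]) linarith
  from Maclaurin[OF zero_less_one _ refl this] obtain t where
    t: "\<phi> 0 1 = (\<Sum>m<?n. \<phi> m 0 / fact m * 1 ^ m) + \<phi> ?n t / fact ?n * 1 ^ ?n"
    using \<gamma> by auto
  have *: "\<phi> m t / fact m = (\<Sum>\<alpha> | mi_deg \<alpha> = m. mi_power v \<alpha> / mi_fact \<alpha> * mi_deriv (\<gamma> + \<alpha>) f (x + t *\<^sub>R v))" for m t
    unfolding \<phi>_def sum_divide_distrib by (intro sum.cong) auto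
  have "(\<Sum>m<?n. \<phi> m 0 / fact m * 1 ^ m) = (\<Sum>m<?n. \<Sum>\<alpha> | mi_deg \<alpha> = m. mi_power v \<alpha> / mi_fact \<alpha> * mi_deriv (\<gamma> + \<alpha>) f x)"
    by (simp add: *)
  also have "\<dots> = (\<Sum>m<?n. \<Sum>\<alpha> \<in> {\<alpha> \<in> {\<alpha>. mi_deg \<alpha> < ?n}. mi_deg \<alpha> = m}. mi_power v \<alpha> / mi_fact \<alpha> * mi_deriv (\<gamma> + \<alpha>) f x)"
    by (intro sum.cong refl) auto
  also have "\<dots> = (\<Sum>\<alpha> | mi_deg \<alpha> < ?n. mi_power v \<alpha> / mi_fact \<alpha> * mi_deriv (\<gamma> + \<alpha>) f x)"
    by (rule sum.group) auto
  finally have "(\<Sum>m<?n. \<phi> m 0 / fact m * 1 ^ m) = \<dots>" .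
  moreover have "\<phi> 0 1 = mi_deriv \<gamma> f (x + v)"
    by (simp add: \<phi>_def)
  ultimately show ?thesis
    using t by (intro that[of t]) (simp add: *)
qed

section \<open>Shifted Riemann sums over a lattice\<close>

text \<open>\<open>z - lattice_pt \<delta> (lattice_idx \<delta> z y)\<close> is the upper corner of the half-open cube of side \<open>\<delta>\<close>
  that contains \<open>y\<close> in the tiling of the space with corners \<open>z - lattice_pt \<delta> m\<close>.\<close>

definition lattice_idx :: "real \<Rightarrow> real ^ 'n \<Rightarrow> real ^ 'n \<Rightarrow> int ^ 'n"
  where "lattice_idx \<delta> z y = (\<chi> i. \<lfloor>(z $ i - y $ i) / \<delta>\<rfloor>)"

lemma lattice_idx_eq_iff:
  assumes "\<delta> > 0"
  shows "lattice_idx \<delta> z y = m \<longleftrightarrow>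
    (\<forall>i. (z - lattice_pt \<delta> m) $ i - \<delta> < y $ i \<and> y $ i \<le> (z - lattice_pt \<delta> m) $ i)"
proof -
  have "\<lfloor>(z $ i - y $ i) / \<delta>\<rfloor> = m $ i \<longleftrightarrow>
      (z - lattice_pt \<delta> m) $ i - \<delta> < y $ i \<and> y $ i \<le> (z - lattice_pt \<delta> m) $ i" for i
    using assms by (auto simp: floor_eq_iff lattice_pt_def field_simps)
  then show ?thesis by (auto simp: lattice_idx_def vec_eq_iff)
qed

lemma norm_sub_nearest_lattice_pt_le:
  fixes y :: "real ^ 'n::finite"
  assumes "\<delta> > 0"
  shows "norm (z - lattice_pt \<delta> (lattice_idx \<delta> z y) - y) \<le> real CARD('n) * \<delta>"
proof -
  let ?w = "z - lattice_pt \<delta> (lattice_idx \<delta> z y) - y"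
  have "\<bar>?w $ i\<bar> \<le> \<delta>" for i
    using lattice_idx_eq_iff[OF assms, of z y "lattice_idx \<delta> z y"] assms
    by (smt (verit, best) vector_minus_component)
  then have "(\<Sum>i\<in>UNIV. \<bar>?w $ i\<bar>) \<le> (\<Sum>i\<in>(UNIV::'n set). \<delta>)"
    by (intro sum_mono)
  then show ?thesis
    using norm_le_l1_cart[of ?w] by simp
qed

lemma emeasure_lattice_cell:
  fixes z :: "real ^ 'n::finite"
  assumes "\<delta> > 0"
  shows "{y. lattice_idx \<delta> z y = m} \<in> sets lborel"
    and "emeasure lborel {y. lattice_idx \<delta> z y = m} = ennreal (\<delta> ^ CARD('n))"
proof -
  let ?S = "{y. lattice_idx \<delta> z y = m}"
  define b where "b = z - lattice_pt \<delta> m"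
  define a where "a = b - (\<chi> i. \<delta>)"
  have S: "?S = {y. \<forall>i. a $ i < y $ i \<and> y $ i \<le> b $ i}"
    unfolding lattice_idx_eq_iff[OF assms] by (simp add: a_def b_def)
  show meas: "?S \<in> sets lborel"
    unfolding S by (simp add: pred_def[symmetric])
  have "(\<Prod>i\<in>Basis. (b - a) \<bullet> i) = \<delta> ^ CARD('n)"
  proof -
    have "(b - a) \<bullet> i = \<delta>" if "i \<in> Basis" for i
      using that by (auto simp: a_def Basis_vec_def inner_axis)
    then show ?thesis by simp
  qed
  moreover have "a \<bullet> i \<le> b \<bullet> i" if "i \<in> Basis" for i
    using that assms by (auto simp: a_def Basis_vec_def inner_axis)
  ultimately have "emeasure lborel (box a b) = ennreal (\<delta> ^ CARD('n))"
    "emeasure lborel (cbox a b) = ennreal (\<delta> ^ CARD('n))"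
    by (simp_all add: emeasure_lborel_box_eq emeasure_lborel_cbox_eq)
  moreover have "box a b \<subseteq> ?S" "?S \<subseteq> cbox a b"
    unfolding S by (auto simp: mem_box_cart less_imp_le)
  ultimately show "emeasure lborel ?S = ennreal (\<delta> ^ CARD('n))"
    by (metis antisym emeasure_mono meas sets_lborel cbox_borel)
qed

lemma measurable_lattice_idx [measurable]:
  fixes z :: "real ^ 'n::finite"
  assumes "\<delta> > 0"
  shows "lattice_idx \<delta> z \<in> measurable lborel (count_space UNIV)"
proof (rule measurable_count_space_eq2_countable[THEN iffD2], intro conjI ballI)
  fix m :: "int ^ 'n"
  have "lattice_idx \<delta> z -` {m} \<inter> space lborel = {y. lattice_idx \<delta> z y = m}"
    by auto
  then show "lattice_idx \<delta> z -` {m} \<inter> space lborel \<in> sets lborel"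
    using emeasure_lattice_cell(1)[OF assms] by simp
qed auto

text \<open>All cells have volume \<open>\<delta> ^ CARD('n)\<close>, so the index of the cell of a point is distributed by a
  multiple of the counting measure. Lattice sums are therefore integrals of step functions.\<close>

lemma distr_lattice_idx:
  fixes z :: "real ^ 'n::finite"
  assumes "\<delta> > 0"
  shows "distr lborel (count_space UNIV) (lattice_idx \<delta> z) =
    density (count_space UNIV) (\<lambda>_. ennreal (\<delta> ^ CARD('n)))"
proof (rule measure_eqI_countable[where A = UNIV])
  fix m :: "int ^ 'n"
  have "lattice_idx \<delta> z -` {m} \<inter> space lborel = {y. lattice_idx \<delta> z y = m}"
    by auto
  then show "emeasure (distr lborel (count_space UNIV) (lattice_idx \<delta> z)) {m} =
      emeasure (density (count_space UNIV) (\<lambda>_. ennreal (\<delta> ^ CARD('n)))) {m}"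
    using assms
    by (subst emeasure_distr) (auto simp: emeasure_lattice_cell emeasure_density nn_integral_cmult_indicator)
qed auto

lemma lattice_sum_eq_integral:
  fixes F :: "int ^ 'n::finite \<Rightarrow> real" and z :: "real ^ 'n"
  assumes \<delta>: "\<delta> > 0" and int: "integrable lborel (\<lambda>y. F (lattice_idx \<delta> z y))"
  shows "F summable_on UNIV"
    and "\<delta> ^ CARD('n) * (\<Sum>\<^sub>\<infinity>m\<in>UNIV. F m) = (LINT y|lborel. F (lattice_idx \<delta> z y))"
proof -
  have "integrable (distr lborel (count_space UNIV) (lattice_idx \<delta> z)) F"
    using int \<delta> by (subst integrable_distr_eq) auto
  then have "integrable (count_space UNIV) (\<lambda>m. \<delta> ^ CARD('n) *\<^sub>R F m)"
    unfolding distr_lattice_idx[OF \<delta>] using \<delta> by (subst (asm) integrable_density) auto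
  then have F: "integrable (count_space UNIV) F"
    using \<delta> by simp
  then have abs: "Infinite_Set_Sum.abs_summable_on F UNIV"
    by (simp add: abs_summable_on_def)
  then show "F summable_on UNIV"
    using abs_summable_equivalent abs_summable_summable by blast
  have "(LINT y|lborel. F (lattice_idx \<delta> z y)) = (LINT m|distr lborel (count_space UNIV) (lattice_idx \<delta> z). F m)"
    using \<delta> by (intro integral_distr[symmetric]) auto
  also have "\<dots> = (LINT m|count_space UNIV. \<delta> ^ CARD('n) *\<^sub>R F m)"
    unfolding distr_lattice_idx[OF \<delta>] using \<delta> by (intro integral_density) auto
  also have "\<dots> = \<delta> ^ CARD('n) * infsetsum F UNIV"
    by (simp add: infsetsum_def)
  also have "infsetsum F UNIV = (\<Sum>\<^sub>\<infinity>m\<in>UNIV. F m)"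
    by (rule infsetsum_infsum[OF abs])
  finally show "\<delta> ^ CARD('n) * (\<Sum>\<^sub>\<infinity>m\<in>UNIV. F m) = (LINT y|lborel. F (lattice_idx \<delta> z y))" ..
qed

text \<open>The integral is estimated over dyadic balls: a point with \<open>2\<^sup>k \<le> 1 + |x| < 2\<^sup>k\<^sup>+\<^sup>1\<close> lies in the ball of radius \<open>2\<^sup>k\<^sup>+\<^sup>1\<close>, whose
  volume grows like \<open>2\<^sup>k\<^sup>n\<close>, while the function is at most \<open>2\<^sup>-\<^sup>k\<^sup>p\<close> there.\<close>

lemma integrable_decay:
  assumes p: "p > real CARD('n::finite)"
  shows "integrable lborel (\<lambda>x :: real ^ 'n. (1 + norm x) powr (- p))"
proof -
  let ?n = "CARD('n)"
  define V where "V = unit_ball_vol (real ?n)"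
  have V: "V \<ge> 0" by (simp add: V_def)
  define g where "g k x = ennreal (2 powr (- p * real k)) * indicator (ball (0 :: real ^ 'n) (2 ^ Suc k)) x" for k x
  have g_meas: "g k \<in> borel_measurable lborel" for k
    unfolding g_def
    by (intro borel_measurable_times_ennreal borel_measurable_const borel_measurable_indicator) simp
  have le: "ennreal ((1 + norm x) powr (- p)) \<le> (\<Sum>k. g k x)" for x
  proof -
    define k where "k = nat \<lfloor>log 2 (1 + norm x)\<rfloor>"
    have "log 2 (1 + norm x) \<ge> 0"
      by (simp add: add_pos_nonneg)
    then have k: "real k \<le> log 2 (1 + norm x)" "log 2 (1 + norm x) < real (Suc k)"
      unfolding k_def by linarith+
    have pos: "1 + norm x > 0" by (simp add: add_pos_nonneg)
    have lo: "2 powr real k \<le> 1 + norm x"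
      using k(1) pos by (simp add: le_log_iff)
    have "1 + norm x < 2 powr real (Suc k)"
      using k(2) pos by (subst (asm) log_less_iff) auto
    then have "norm x < 2 ^ Suc k"
      by (simp only: powr_realpow zero_less_numeral)
    then have "g k x = ennreal (2 powr (- p * real k))"
      by (simp add: g_def)
    moreover have "(1 + norm x) powr (- p) \<le> (2 powr real k) powr (- p)"
      using lo p by (intro powr_mono2') auto
    ultimately have "ennreal ((1 + norm x) powr (- p)) \<le> g k x"
      by (simp add: powr_powr mult.commute ennreal_leI)
    also have "\<dots> \<le> (\<Sum>k. g k x)"
      using sum_le_suminf[of "\<lambda>k. g k x" "{k}"] by (simp add: summableI)
    finally show ?thesis .
  qed
  have geo: "2 powr (real ?n - p) < 1"
    using p by (simp add: powr_less_one)
  have "(\<integral>\<^sup>+x. ennreal ((1 + norm (x :: real ^ 'n)) powr (- p)) \<partial>lborel) \<le> (\<integral>\<^sup>+x. (\<Sum>k. g k x) \<partial>lborel)"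
    by (intro nn_integral_mono le)
  also have "\<dots> = (\<Sum>k. \<integral>\<^sup>+x. g k x \<partial>lborel)"
    by (rule nn_integral_suminf[OF g_meas])
  also have "\<dots> = (\<Sum>k. ennreal (2 ^ ?n * V * (2 powr (real ?n - p)) ^ k))"
  proof (intro suminf_cong)
    fix k :: nat
    have "(\<integral>\<^sup>+x. g k x \<partial>lborel) = ennreal (2 powr (- p * real k)) * ennreal (V * (2 ^ Suc k) ^ ?n)"
      unfolding g_def V_def by (subst nn_integral_cmult_indicator) (auto simp: emeasure_ball)
    also have "\<dots> = ennreal (2 powr (- p * real k) * (V * (2 ^ Suc k) ^ ?n))"
      by (subst ennreal_mult) (auto simp: V)
    also have "2 powr (- p * real k) * (V * (2 ^ Suc k) ^ ?n) = 2 ^ ?n * V * (2 powr (real ?n - p)) ^ k"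
    proof -
      have "(2 powr (real ?n - p)) ^ k = 2 powr ((real ?n - p) * real k)"
        by (simp add: powr_power mult.commute)
      also have "(real ?n - p) * real k = - p * real k + real (k * ?n)"
        by (simp add: algebra_simps)
      also have "2 powr (- p * real k + real (k * ?n)) = 2 powr (- p * real k) * (2 ^ k) ^ ?n"
        by (simp only: powr_add powr_realpow power_mult zero_less_numeral)
      finally show ?thesis by (simp add: power_mult_distrib)
    qed
    finally show "(\<integral>\<^sup>+x. g k x \<partial>lborel) = ennreal (2 ^ ?n * V * (2 powr (real ?n - p)) ^ k)" .
  qed
  also have "\<dots> < \<infinity>"
    using geo V by (subst suminf_ennreal2) (auto intro!: summable_mult summable_geometric)
  finally show ?thesis
    by (intro integrableI_bounded) (auto simp: )
qed

text \<open>Moving a point to the corner of its cell changes its norm by a bounded amount, hence its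
  weight by a bounded factor.\<close>

lemma decay_lattice_step:
  fixes y z :: "real ^ 'n::finite"
  assumes \<delta>: "\<delta> > 0" and p: "p \<ge> 0"
  shows "(1 + norm (z - lattice_pt \<delta> (lattice_idx \<delta> z y))) powr (- p)
     \<le> (1 + real CARD('n) * \<delta>) powr p * (1 + norm y) powr (- p)"
proof -
  let ?s = "z - lattice_pt \<delta> (lattice_idx \<delta> z y)" and ?q = "1 + real CARD('n) * \<delta>"
  have q: "?q \<ge> 1" using \<delta> by simp
  have "norm y \<le> norm ?s + real CARD('n) * \<delta>"
    using norm_sub_nearest_lattice_pt_le[OF \<delta>, of z y] norm_triangle_sub[of y ?s]
    by (simp add: norm_minus_commute)
  also have "1 + (norm ?s + real CARD('n) * \<delta>) \<le> ?q * (1 + norm ?s)"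
    using \<delta> by (simp add: algebra_simps)
  finally have "(1 + norm y) / ?q \<le> 1 + norm ?s"
    using q by (simp add: pos_divide_le_eq mult.commute)
  then have "(1 + norm ?s) powr (- p) \<le> ((1 + norm y) / ?q) powr (- p)"
    using p q by (intro powr_mono2') (auto simp: add_pos_nonneg)
  also have "\<dots> = ?q powr p * (1 + norm y) powr (- p)"
    using q by (simp add: powr_divide powr_minus field_simps)
  finally show ?thesis .
qed

lemma integrable_lattice_step:
  fixes G :: "real ^ 'n::finite \<Rightarrow> real"
  assumes \<delta>: "\<delta> > 0" and p: "p > real CARD('n)"
    and G: "\<And>x. \<bar>G x\<bar> \<le> A * (1 + norm x) powr (- p)"
  shows "integrable lborel (\<lambda>y. G (z - lattice_pt \<delta> (lattice_idx \<delta> z y)))"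
proof (rule Bochner_Integration.integrable_bound)
  have A: "A \<ge> 0"
    using G[of 0] by simp
  let ?g = "\<lambda>y :: real ^ 'n. A * ((1 + real CARD('n) * \<delta>) powr p * (1 + norm y) powr (- p))"
  show "integrable lborel ?g"
    by (intro integrable_mult_right integrable_decay p)
  show "(\<lambda>y. G (z - lattice_pt \<delta> (lattice_idx \<delta> z y))) \<in> borel_measurable lborel"
    by (rule measurable_compose[OF measurable_lattice_idx[OF \<delta>]]) simp
  have "norm (G (z - lattice_pt \<delta> (lattice_idx \<delta> z y))) \<le> norm (?g y)" for y
  proof -
    have "norm (G (z - lattice_pt \<delta> (lattice_idx \<delta> z y))) \<le> ?g y"
      using order_trans[OF G mult_left_mono[OF decay_lattice_step[OF \<delta>, of p z y] A]] p by simp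
    then show ?thesis by simp
  qed
  then show "AE y in lborel. norm (G (z - lattice_pt \<delta> (lattice_idx \<delta> z y))) \<le> norm (?g y)"
    by simp
qed

lemma decay_lattice_summable:
  fixes G :: "real ^ 'n::finite \<Rightarrow> real"
  assumes "\<delta> > 0" "p > real CARD('n)" "\<And>x. \<bar>G x\<bar> \<le> A * (1 + norm x) powr (- p)"
  shows "(\<lambda>m. G (z - lattice_pt \<delta> m)) summable_on UNIV"
  by (rule lattice_sum_eq_integral(1)[OF assms(1) integrable_lattice_step[OF assms]])

text \<open>If uniformity failed there would be meshes \<open>\<delta> k\<close> tending to \<open>0\<close> and shifts \<open>z k\<close> with a
  fixed error. The Riemann sums are integrals of the step functions that evaluate \<open>G\<close> at the
  corner of the cell of \<open>y\<close>. Whatever the shifts, these corners tend to \<open>y\<close>, and the step functions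
  share an integrable majorant, so dominated convergence gives a contradiction.\<close>

lemma lattice_riemann_sums_uniform:
  fixes G :: "real ^ 'n::finite \<Rightarrow> real"
  assumes p: "p > real CARD('n)" and cont: "continuous_on UNIV G"
    and G: "\<And>x. \<bar>G x\<bar> \<le> A * (1 + norm x) powr (- p)" and e: "e > 0"
  shows "\<forall>\<^sub>F \<delta> in at_right 0. \<forall>z.
    \<bar>\<delta> ^ CARD('n) * (\<Sum>\<^sub>\<infinity>m\<in>UNIV. G (z - lattice_pt \<delta> m)) - (LINT y|lborel. G y)\<bar> < e"
proof (rule ccontr)
  let ?n = "real CARD('n)"
  define S where "S \<delta> z y = z - lattice_pt \<delta> (lattice_idx \<delta> z y)" for \<delta> and z y :: "real ^ 'n"
  assume "\<not> ?thesis"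
  then have "\<forall>k. \<exists>\<delta> z. 0 < \<delta> \<and> \<delta> < inverse (real (Suc k)) \<and>
      \<bar>\<delta> ^ CARD('n) * (\<Sum>\<^sub>\<infinity>m\<in>UNIV. G (z - lattice_pt \<delta> m)) - (LINT y|lborel. G y)\<bar> \<ge> e"
    unfolding eventually_at_right_field not_less[symmetric]
    by (meson inverse_positive_iff_positive of_nat_0_less_iff zero_less_Suc)
  then obtain \<delta> z where \<delta>: "\<And>k. 0 < \<delta> k" "\<And>k. \<delta> k < inverse (real (Suc k))" and
    far: "\<And>k. \<bar>\<delta> k ^ CARD('n) * (\<Sum>\<^sub>\<infinity>m\<in>UNIV. G (z k - lattice_pt (\<delta> k) m)) - (LINT y|lborel. G y)\<bar> \<ge> e"
    by metis
  have \<delta>1: "\<delta> k \<le> 1" for k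
    using \<delta>(2)[of k] by (smt (verit, best) inverse_le_1_iff of_nat_Suc of_nat_0_le_iff)
  have A: "A \<ge> 0"
    using G[of 0] by simp
  have "(\<lambda>k. LINT y|lborel. G (S (\<delta> k) (z k) y)) \<longlonglongrightarrow> (LINT y|lborel. G y)"
  proof (rule integral_dominated_convergence)
    show "integrable lborel (\<lambda>y :: real ^ 'n. A * ((1 + ?n) powr p * (1 + norm y) powr (- p)))"
      by (intro integrable_mult_right integrable_decay p)
    show "G \<in> borel_measurable lborel"
      using cont by (simp add: borel_measurable_continuous_onI)
    show "(\<lambda>y. G (S (\<delta> k) (z k) y)) \<in> borel_measurable lborel" for k
      unfolding S_def by (rule measurable_compose[OF measurable_lattice_idx[OF \<delta>(1)]]) simp
    show "AE y in lborel. norm (G (S (\<delta> k) (z k) y)) \<le> A * ((1 + ?n) powr p * (1 + norm y) powr (- p))" for k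
    proof (rule AE_I2)
      fix y
      have "norm (G (S (\<delta> k) (z k) y)) \<le> A * ((1 + ?n * \<delta> k) powr p * (1 + norm y) powr (- p))"
        using order_trans[OF G mult_left_mono[OF decay_lattice_step[OF \<delta>(1)[of k], of p "z k" y] A]] p
        by (simp add: S_def)
      also have "\<dots> \<le> A * ((1 + ?n) powr p * (1 + norm y) powr (- p))"
        using A p \<delta>(1)[of k] \<delta>1[of k]
        by (intro mult_left_mono mult_right_mono powr_mono2) (auto simp: mult_left_le)
      finally show "norm (G (S (\<delta> k) (z k) y)) \<le> A * ((1 + ?n) powr p * (1 + norm y) powr (- p))" .
    qed
    show "AE y in lborel. (\<lambda>k. G (S (\<delta> k) (z k) y)) \<longlonglongrightarrow> G y"
    proof (rule AE_I2)
      fix y :: "real ^ 'n"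
      have "norm (S (\<delta> k) (z k) y - y) \<le> ?n * inverse (real (Suc k))" for k
        using norm_sub_nearest_lattice_pt_le[OF \<delta>(1)[of k], of "z k" y] \<delta>(2)[of k]
        by (smt (verit, best) S_def mult_left_mono of_nat_0_le_iff)
      then have "(\<lambda>k. S (\<delta> k) (z k) y - y) \<longlonglongrightarrow> 0"
        using tendsto_mult_right_zero[OF LIMSEQ_inverse_real_of_nat]
        by (rule Lim_null_comparison[OF always_eventually, rule_format])
      then have "(\<lambda>k. S (\<delta> k) (z k) y) \<longlonglongrightarrow> y"
        by (simp add: LIM_zero_iff)
      moreover have "isCont G y"
        using cont by (auto simp: continuous_on_eq_continuous_at)
      ultimately show "(\<lambda>k. G (S (\<delta> k) (z k) y)) \<longlonglongrightarrow> G y"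
        by (rule isCont_tendsto_compose[rotated])
    qed
  qed
  moreover have "(LINT y|lborel. G (S (\<delta> k) (z k) y)) =
      \<delta> k ^ CARD('n) * (\<Sum>\<^sub>\<infinity>m\<in>UNIV. G (z k - lattice_pt (\<delta> k) m))" for k
    unfolding S_def
    by (rule lattice_sum_eq_integral(2)[OF \<delta>(1) integrable_lattice_step[OF \<delta>(1) p G], symmetric])
  ultimately have "(\<lambda>k. \<delta> k ^ CARD('n) * (\<Sum>\<^sub>\<infinity>m\<in>UNIV. G (z k - lattice_pt (\<delta> k) m)))
      \<longlonglongrightarrow> (LINT y|lborel. G y)"
    by simp
  from LIMSEQ_D[OF this e] far show False
    by (auto simp: not_less[symmetric])
qed

section \<open>Smooth bump functions\<close>

text \<open>With \<open>p = 1\<close> this is the standard smooth function that vanishes to infinite order at \<open>0\<close>; the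
  polynomial factor makes the family closed under differentiation.\<close>

definition flat :: "real poly \<Rightarrow> real \<Rightarrow> real"
  where "flat p t = (if t > 0 then poly p (1 / t) * exp (- (1 / t)) else 0)"

lemma poly_times_exp_minus_tendsto_0: "((\<lambda>y. poly p y * exp (- y)) \<longlongrightarrow> (0 :: real)) at_top"
proof -
  have "((\<lambda>y. \<Sum>i\<le>degree p. coeff p i * (y ^ i / exp y)) \<longlongrightarrow> (\<Sum>i\<le>degree p. coeff p i * (0 :: real))) at_top"
    by (intro tendsto_sum tendsto_mult_left tendsto_power_div_exp_0)
  then show ?thesis
    by (simp add: poly_altdef sum_distrib_right exp_minus divide_inverse mult.assoc)
qed

lemma flat_tendsto_0: "((\<lambda>t. poly p (1 / t) * exp (- (1 / t))) \<longlongrightarrow> (0 :: real)) (at_right 0)"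
  using filterlim_compose[OF poly_times_exp_minus_tendsto_0 filterlim_inverse_at_top_right]
  by (simp add: divide_inverse)

lemma DERIV_flat: "DERIV (flat p) t :> flat ([:0, 0, 1:] * (p - pderiv p)) t"
proof -
  consider "t > 0" | "t < 0" | "t = 0" by linarith
  then show ?thesis
  proof cases
    case 1
    have "DERIV (\<lambda>t. poly p (1 / t) * exp (- (1 / t))) t :> flat ([:0, 0, 1:] * (p - pderiv p)) t"
      using 1 by (auto intro!: derivative_eq_intros simp: flat_def field_simps power2_eq_square)
    moreover have "\<forall>\<^sub>F s in nhds t. flat p s = poly p (1 / s) * exp (- (1 / s))"
      using eventually_nhds_in_open[of "{0<..}" t] 1 by (auto elim!: eventually_mono simp: flat_def)
    ultimately show ?thesis
      by (subst DERIV_cong_ev[OF refl _ refl])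
  next
    case 2
    have "\<forall>\<^sub>F s in nhds t. flat p s = 0"
      using eventually_nhds_in_open[of "{..<0}" t] 2 by (auto elim!: eventually_mono simp: flat_def)
    then have "DERIV (flat p) t :> 0"
      by (subst DERIV_cong_ev[OF refl _ refl]) auto
    with 2 show ?thesis by (simp add: flat_def)
  next
    case 3
    have "((\<lambda>h. flat p h / h) \<longlongrightarrow> 0) (at_right 0)"
    proof (rule Lim_transform_eventually[OF flat_tendsto_0[of "[:0, 1:] * p"]])
      show "\<forall>\<^sub>F h in at_right 0. poly ([:0, 1:] * p) (1 / h) * exp (- (1 / h)) = flat p h / h"
        using eventually_at_right_less[of 0] by eventually_elim (simp add: flat_def)
    qed
    moreover have "((\<lambda>h. flat p h / h) \<longlongrightarrow> 0) (at_left 0)"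
    proof (rule Lim_transform_eventually[OF tendsto_const])
      show "\<forall>\<^sub>F h in at_left 0. 0 = flat p h / h"
        by (auto simp: eventually_at_filter flat_def)
    qed
    ultimately have "((\<lambda>h. flat p h / h) \<longlongrightarrow> 0) (at 0)"
      by (simp add: filterlim_split_at)
    with 3 show ?thesis by (simp add: DERIV_def flat_def)
  qed
qed

text \<open>An algebra of functions that is closed under partial derivatives: since all its members are
  differentiable, they are differentiable infinitely often, and no higher derivative has to be
  computed. It contains the radial bump functions.\<close>

inductive_set bump_algebra :: "(real ^ 'n::finite \<Rightarrow> real) set" where
  const: "(\<lambda>x. c) \<in> bump_algebra"
| coord: "(\<lambda>x. x $ i) \<in> bump_algebra"
| add: "f \<in> bump_algebra \<Longrightarrow> g \<in> bump_algebra \<Longrightarrow> (\<lambda>x. f x + g x) \<in> bump_algebra"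
| mult: "f \<in> bump_algebra \<Longrightarrow> g \<in> bump_algebra \<Longrightarrow> (\<lambda>x. f x * g x) \<in> bump_algebra"
| flat: "f \<in> bump_algebra \<Longrightarrow> (\<lambda>x. flat p (f x)) \<in> bump_algebra"

lemma bump_algebra_closed:
  fixes f :: "real ^ 'n::finite \<Rightarrow> real"
  assumes "f \<in> bump_algebra"
  shows "(\<forall>x. f differentiable at x) \<and> (\<forall>i. partial i f \<in> bump_algebra)"
  using assms
proof induction
  case (const c)
  have "partial i (\<lambda>x. c) = (\<lambda>x. 0)" for i :: 'n
    by (rule ext, rule has_derivative_imp_partial) simp
  then show ?case by (auto intro: bump_algebra.const)
next
  case (coord j)
  have d: "((\<lambda>x :: real ^ 'n. x $ j) has_derivative (\<lambda>v. v $ j)) (at x)" for x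
    by (intro bounded_linear_imp_has_derivative bounded_linear_vec_nth)
  have "partial i (\<lambda>x. x $ j) = (\<lambda>x. axis i 1 $ j)" for i :: 'n
    by (rule ext, rule has_derivative_imp_partial[OF d])
  then show ?case using d by (auto intro: bump_algebra.const simp: differentiable_def)
next
  case (add f g)
  have "partial i (\<lambda>x. f x + g x) = (\<lambda>x. partial i f x + partial i g x)" for i :: 'n
  proof
    fix x
    obtain f' g' where d: "(f has_derivative f') (at x)" "(g has_derivative g') (at x)"
      using add.IH by (meson differentiable_def)
    show "partial i (\<lambda>x. f x + g x) x = partial i f x + partial i g x"
      by (simp add: has_derivative_imp_partial[OF has_derivative_add[OF d]] has_derivative_imp_partial[OF d(1)] has_derivative_imp_partial[OF d(2)])
  qed
  with add.IH show ?case by (auto intro: bump_algebra.add)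
next
  case (mult f g)
  have "partial i (\<lambda>x. f x * g x) = (\<lambda>x. f x * partial i g x + partial i f x * g x)" for i :: 'n
  proof
    fix x
    obtain f' g' where d: "(f has_derivative f') (at x)" "(g has_derivative g') (at x)"
      using mult.IH by (meson differentiable_def)
    show "partial i (\<lambda>x. f x * g x) x = f x * partial i g x + partial i f x * g x"
      by (simp add: has_derivative_imp_partial[OF has_derivative_mult[OF d]] has_derivative_imp_partial[OF d(1)] has_derivative_imp_partial[OF d(2)])
  qed
  then show ?case
    using mult by (simp add: bump_algebra.add bump_algebra.mult)
next
  case (flat f p)
  let ?q = "[:0, 0, 1:] * (p - pderiv p)"
  have d: "((\<lambda>x. flat p (f x)) has_derivative (\<lambda>v. flat ?q (f x) * f' v)) (at x)"
    if "(f has_derivative f') (at x)" for f' x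
    using has_derivative_compose[OF that has_field_derivative_imp_has_derivative[OF DERIV_flat]] .
  have "partial i (\<lambda>x. flat p (f x)) = (\<lambda>x. flat ?q (f x) * partial i f x)" for i :: 'n
  proof
    fix x
    obtain f' where f': "(f has_derivative f') (at x)"
      using flat.IH by (meson differentiable_def)
    show "partial i (\<lambda>x. flat p (f x)) x = flat ?q (f x) * partial i f x"
      by (simp only: has_derivative_imp_partial[OF d[OF f']] has_derivative_imp_partial[OF f'])
  qed
  moreover have "(\<lambda>x. flat p (f x)) differentiable at x" for x
    using flat.IH d by (meson differentiable_def)
  ultimately show ?case
    using flat by (auto intro: bump_algebra.flat bump_algebra.mult)
qed

lemma bump_algebra_C_class:
  assumes "f \<in> bump_algebra"
  shows "f \<in> C_class k"
proof -
  have "partials is f \<in> bump_algebra" for "is"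
    using assms by (induction "is") (auto simp: bump_algebra_closed)
  then have "partials is f differentiable at x" for "is" x
    using bump_algebra_closed by blast
  then show ?thesis
    by (auto simp: C_class_def times_differentiable_def continuous_on_eq_continuous_at
        intro: differentiable_imp_continuous_within)
qed

lemma exists_bump:
  fixes a :: "real ^ 'n::finite"
  assumes r: "r > 0"
  obtains \<phi> where "\<phi> \<in> test_functions" "\<And>x. \<phi> x \<ge> 0" "\<And>x. \<phi> x > 0 \<longleftrightarrow> dist a x < r"
proof -
  \<comment> \<open>\<open>flat 1 (r\<^sup>2 - |x - a|\<^sup>2)\<close>, spelled out with the operations of \<open>bump_algebra\<close>\<close>
  define \<phi> where "\<phi> x = flat 1 (r\<^sup>2 + (- 1) * (\<Sum>i\<in>UNIV. (x $ i + - a $ i) * (x $ i + - a $ i)))" for x :: "real ^ 'n"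
  have "(\<lambda>x :: real ^ 'n. \<Sum>i\<in>I. (x $ i + - a $ i) * (x $ i + - a $ i)) \<in> bump_algebra" if "finite I" for I
    using that
  proof induction
    case (insert i I)
    show ?case
      unfolding sum.insert[OF insert.hyps(1,2)] by (intro bump_algebra.intros insert.IH)
  qed (simp add: bump_algebra.const)
  then have "\<phi> \<in> bump_algebra"
    unfolding \<phi>_def by (intro bump_algebra.intros) simp
  then have smooth: "\<phi> \<in> C_class k" for k
    by (rule bump_algebra_C_class)
  have sq: "(\<Sum>i\<in>UNIV. (x $ i + - a $ i) * (x $ i + - a $ i)) = (dist a x)\<^sup>2" for x
    by (simp add: dist_norm norm_minus_commute[of a x] power2_norm_eq_inner inner_vec_def)
  have \<phi>: "\<phi> x = flat 1 (r\<^sup>2 - (dist a x)\<^sup>2)" for x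
    unfolding \<phi>_def sq by simp
  have pos: "\<phi> x > 0 \<longleftrightarrow> dist a x < r" for x
  proof -
    have "\<phi> x > 0 \<longleftrightarrow> (dist a x)\<^sup>2 < r\<^sup>2" by (simp add: \<phi> flat_def)
    also have "\<dots> \<longleftrightarrow> dist a x < r"
      using r by (meson abs_le_square_iff less_imp_le not_less power2_less_imp_less power_strict_mono zero_le_dist pos2)
    finally show ?thesis .
  qed
  have nonneg: "\<phi> x \<ge> 0" for x by (simp add: \<phi> flat_def)
  have "{x. \<phi> x \<noteq> 0} \<subseteq> cball a r"
    using pos nonneg by (auto simp: less_le)
  then have "compact (closure {x. \<phi> x \<noteq> 0})"
    using bounded_subset bounded_cball compact_closure by blast
  with smooth have "\<phi> \<in> test_functions"
    by (auto simp: test_functions_def)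
  then show ?thesis using that nonneg pos by blast
qed

section \<open>Integration by parts against test functions\<close>

lemma partial_mult:
  assumes "f differentiable at x" "g differentiable at x"
  shows "partial i (\<lambda>x. f x * g x) x = f x * partial i g x + partial i f x * g x"
proof -
  obtain f' g' where d: "(f has_derivative f') (at x)" "(g has_derivative g') (at x)"
    using assms by (meson differentiable_def)
  show ?thesis
    by (simp add: has_derivative_imp_partial[OF has_derivative_mult[OF d]]
        has_derivative_imp_partial[OF d(1)] has_derivative_imp_partial[OF d(2)])
qed

lemma partial_eq_0_outside:
  assumes "\<And>y. norm y > R \<Longrightarrow> f y = 0" "norm x > R"
  shows "partial i f x = 0"
proof -
  have "open {y :: real ^ 'n. R < norm y}"
    by (intro open_Collect_less continuous_intros)
  then have "(f has_derivative (\<lambda>_. 0)) (at x)"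
    by (rule has_derivative_transform_within_open[OF has_derivative_const[of 0]]) (use assms in auto)
  then show ?thesis
    by (rule has_derivative_imp_partial)
qed

lemma partials_eq_0_outside:
  assumes "\<And>y. norm y > R \<Longrightarrow> f y = 0" "norm x > R"
  shows "partials is f x = 0"
  using assms(2)
proof (induction "is" arbitrary: x)
  case (Cons i "is")
  then show ?case using partial_eq_0_outside[of R "partials is f"] by simp
qed (use assms(1) in simp)

lemma integrable_compact_support:
  fixes f :: "real ^ 'n::finite \<Rightarrow> real"
  assumes "continuous_on UNIV f" "\<And>x. norm x > R \<Longrightarrow> f x = 0"
  shows "integrable lborel f"
proof -
  have "integrable lborel (\<lambda>x. indicator (cball 0 R) x *\<^sub>R f x)"
    using borel_integrable_compact[of "cball 0 R" f] assms(1) continuous_on_subset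
    by (auto simp: set_integrable_def)
  also have "(\<lambda>x. indicator (cball 0 R) x *\<^sub>R f x) = f"
    using assms(2) by (force simp: indicator_def)
  finally show ?thesis .
qed

text \<open>The integral of \<open>F\<close> is invariant under translation in direction \<open>i\<close>, so all its difference
  quotients in this direction have integral \<open>0\<close>; they converge to the partial derivative, dominated
  by a multiple of the indicator of a ball.\<close>

lemma integral_partial_eq_0:
  fixes F :: "real ^ 'n::finite \<Rightarrow> real"
  assumes F: "\<And>x. F differentiable at x" and cont: "continuous_on UNIV (partial i F)"
    and supp: "\<And>x. norm x > R \<Longrightarrow> F x = 0"
  shows "(LINT x|lborel. partial i F x) = 0"
proof -
  let ?e = "axis i 1 :: real ^ 'n"
  define t where "t k = inverse (real (Suc k))" for k
  have t: "t k > 0" "t k \<le> 1" for k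
    by (auto simp: t_def inverse_le_1_iff)
  have t0: "t \<longlonglongrightarrow> 0"
    unfolding t_def by (rule LIMSEQ_inverse_real_of_nat)
  define q where "q k x = (F (x + t k *\<^sub>R ?e) - F x) / t k" for k x
  have Fcont: "continuous_on UNIV F"
    using F by (auto simp: continuous_on_eq_continuous_at intro: differentiable_imp_continuous_within)
  have Fint: "integrable lborel F"
    using Fcont supp by (rule integrable_compact_support)
  have shift: "integrable lborel (\<lambda>x. F (x + t k *\<^sub>R ?e))"
    "(LINT x|lborel. F (x + t k *\<^sub>R ?e)) = (LINT x|lborel. F x)" for k
  proof -
    have *: "distr lborel borel (\<lambda>x. t k *\<^sub>R ?e + x) = (lborel :: (real ^ 'n) measure)"
      by (rule lborel_distr_plus)
    have "integrable (distr lborel borel (\<lambda>x. t k *\<^sub>R ?e + x)) F"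
      using Fint by (simp add: *)
    then show "integrable lborel (\<lambda>x. F (x + t k *\<^sub>R ?e))"
      by (subst (asm) integrable_distr_eq) (auto simp: add.commute borel_measurable_continuous_onI Fcont)
    have "(LINT x|lborel. F x) = (LINT x|distr lborel borel (\<lambda>x. t k *\<^sub>R ?e + x). F x)"
      by (simp add: *)
    also have "\<dots> = (LINT x|lborel. F (x + t k *\<^sub>R ?e))"
      by (subst integral_distr) (auto simp: add.commute borel_measurable_continuous_onI Fcont)
    finally show "(LINT x|lborel. F (x + t k *\<^sub>R ?e)) = (LINT x|lborel. F x)" ..
  qed
  have "bounded (partial i F ` cball 0 (R + 2))"
    by (intro compact_imp_bounded compact_continuous_image continuous_on_subset[OF cont]) auto
  then obtain B where B: "\<And>x. norm x \<le> R + 2 \<Longrightarrow> \<bar>partial i F x\<bar> \<le> B"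
    unfolding bounded_iff by (metis image_eqI mem_cball_0 real_norm_def)
  have "(\<lambda>k. LINT x|lborel. q k x) \<longlonglongrightarrow> (LINT x|lborel. partial i F x)"
  proof (rule integral_dominated_convergence)
    show "partial i F \<in> borel_measurable lborel"
      using cont by (simp add: borel_measurable_continuous_onI)
    show "q k \<in> borel_measurable lborel" for k
      using shift(1)[of k] Fint unfolding q_def by simp
    show "integrable lborel (\<lambda>x. B * indicator (cball (0 :: real ^ 'n) (R + 1)) x)"
      using emeasure_bounded_finite[OF bounded_cball]
      by (intro integrable_mult_right integrable_real_indicator) auto
    show "AE x in lborel. norm (q k x) \<le> B * indicator (cball 0 (R + 1)) x" for k
    proof (rule AE_I2)
      fix x
      have d: "DERIV (\<lambda>s. F (x + s *\<^sub>R ?e)) s :> partial i F (x + s *\<^sub>R ?e)" for s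
        by (rule has_real_derivative_axis[OF F])
      obtain s where s: "0 < s" "s < t k" and mvt: "q k x = partial i F (x + s *\<^sub>R ?e)"
        using MVT2[OF t(1)[of k] d] t(1)[of k] by (auto simp: q_def field_simps)
      have close: "norm (x + c *\<^sub>R ?e) \<le> norm x + 1" "norm x \<le> norm (x + c *\<^sub>R ?e) + 1"
        if "0 < c" "c \<le> 1" for c
        using norm_triangle_ineq[of x "c *\<^sub>R ?e"] norm_triangle_ineq4[of "x + c *\<^sub>R ?e" "c *\<^sub>R ?e"] that
        by auto
      show "norm (q k x) \<le> B * indicator (cball 0 (R + 1)) x"
      proof (cases "norm x \<le> R + 1")
        case True
        then show ?thesis using mvt B[of "x + s *\<^sub>R ?e"] close(1)[of s] s t(2)[of k] by simp
      next
        case False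
        then have "q k x = 0"
          using supp[of x] supp[of "x + t k *\<^sub>R ?e"] close(2)[of "t k"] t[of k] by (simp add: q_def)
        with False show ?thesis by simp
      qed
    qed
    show "AE x in lborel. (\<lambda>k. q k x) \<longlonglongrightarrow> partial i F x"
    proof (rule AE_I2)
      fix x
      have "DERIV (\<lambda>s. F (x + s *\<^sub>R ?e)) 0 :> partial i F x"
        using has_real_derivative_axis[of F x 0 i] F by simp
      then have "((\<lambda>s. (F (x + s *\<^sub>R ?e) - F x) / s) \<longlongrightarrow> partial i F x) (at 0)"
        by (simp add: DERIV_def)
      moreover have "filterlim t (at 0) sequentially"
        using t0 t(1) by (auto simp: filterlim_at less_imp_neq[symmetric] intro!: always_eventually)
      ultimately show "(\<lambda>k. q k x) \<longlonglongrightarrow> partial i F x"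
        unfolding q_def by (rule filterlim_compose)
    qed
  qed
  moreover have "(LINT x|lborel. q k x) = 0" for k
    unfolding q_def using shift[of k] Fint by simp
  ultimately show ?thesis
    by (simp add: LIMSEQ_const_iff)
qed

lemma integral_by_parts:
  fixes u \<psi> :: "real ^ 'n::finite \<Rightarrow> real"
  assumes u: "u \<in> C_class (Suc k)" and \<psi>: "\<psi> \<in> C_class (Suc l)"
    and supp: "\<And>x. norm x > R \<Longrightarrow> \<psi> x = 0"
  shows "(LINT x|lborel. u x * partial i \<psi> x) = - (LINT x|lborel. partial i u x * \<psi> x)"
proof -
  have d: "u differentiable at x" "\<psi> differentiable at x" for x
    using C_class_differentiable[OF u, of "[]"] C_class_differentiable[OF \<psi>, of "[]"] by auto
  have c: "continuous_on UNIV u" "continuous_on UNIV \<psi>"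
    using C_class_continuous[OF u, of "[]"] C_class_continuous[OF \<psi>, of "[]"] by auto
  have pc: "continuous_on UNIV (partial i u)" "continuous_on UNIV (partial i \<psi>)"
    using C_class_continuous[OF u, of "[i]"] C_class_continuous[OF \<psi>, of "[i]"] by auto
  have eq: "partial i (\<lambda>x. u x * \<psi> x) = (\<lambda>x. u x * partial i \<psi> x + partial i u x * \<psi> x)"
    using partial_mult[OF d] by blast
  have i1: "integrable lborel (\<lambda>x. u x * partial i \<psi> x)"
    by (rule integrable_compact_support[where R = R]) (use c pc supp partial_eq_0_outside[where f = \<psi>, OF supp] in \<open>auto intro!: continuous_intros\<close>)
  have i2: "integrable lborel (\<lambda>x. partial i u x * \<psi> x)"
    by (rule integrable_compact_support[where R = R]) (use c pc supp in \<open>auto intro!: continuous_intros\<close>)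
  have "(LINT x|lborel. partial i (\<lambda>x. u x * \<psi> x) x) = 0"
  proof (rule integral_partial_eq_0)
    show "(\<lambda>x. u x * \<psi> x) differentiable at x" for x
      using d by simp
    show "continuous_on UNIV (partial i (\<lambda>x. u x * \<psi> x))"
      unfolding eq using c pc by (intro continuous_intros)
    show "u x * \<psi> x = 0" if "norm x > R" for x
      using supp that by simp
  qed
  then show ?thesis
    unfolding eq using i1 i2 by simp
qed

text \<open>Each integration by parts removes the outermost differentiation from \<open>\<phi>\<close> and applies it to
  \<open>u\<close> as the innermost one; this is why the list is reversed.\<close>

lemma integral_by_parts_iterated:
  fixes u \<phi> :: "real ^ 'n::finite \<Rightarrow> real"
  assumes "u \<in> C_class k" "length is \<le> k" and \<phi>: "\<And>l. \<phi> \<in> C_class l"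
    and supp: "\<And>x. norm x > R \<Longrightarrow> \<phi> x = 0"
  shows "(LINT x|lborel. u x * partials is \<phi> x) =
    (- 1) ^ length is * (LINT x|lborel. partials (rev is) u x * \<phi> x)"
  using assms(1,2)
proof (induction "is" arbitrary: u k)
  case (Cons i "is")
  then obtain k' where k: "k = Suc k'" by (cases k) auto
  have "partials is \<phi> \<in> C_class (Suc 0)"
    using C_class_partials[OF \<phi>, of "is" "length is + 1"] by simp
  then have "(LINT x|lborel. u x * partials (i # is) \<phi> x) = - (LINT x|lborel. partial i u x * partials is \<phi> x)"
    using Cons.prems k partials_eq_0_outside[where f = \<phi>, OF supp] by (simp, intro integral_by_parts[where R = R]) auto
  also have "(LINT x|lborel. partial i u x * partials is \<phi> x) =
      (- 1) ^ length is * (LINT x|lborel. partials (rev is) (partial i u) x * \<phi> x)"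
    using Cons.prems k C_class_partials[of u k "[i]"] by (intro Cons.IH[where k = k']) auto
  finally show ?case by simp
qed simp

lemma integral_mult_mi_deriv:
  fixes u \<phi> :: "real ^ 'n::finite \<Rightarrow> real"
  assumes u: "u \<in> C_class k" "mi_deg \<beta> \<le> k" and \<phi>: "\<phi> \<in> test_functions"
  shows "(LINT x|lebesgue. u x * mi_deriv \<beta> \<phi> x) =
    (- 1) ^ mi_deg \<beta> * (LINT x|lebesgue. mi_deriv \<beta> u x * \<phi> x)"
proof -
  have C: "\<phi> \<in> C_class l" for l
    using \<phi> by (simp add: test_functions_def)
  have "bounded (closure {x. \<phi> x \<noteq> 0})"
    using \<phi> by (auto simp: test_functions_def intro: compact_imp_bounded)
  then obtain R where "\<And>x. x \<in> closure {x. \<phi> x \<noteq> 0} \<Longrightarrow> norm x \<le> R"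
    by (auto simp: bounded_iff)
  then have supp: "norm x > R \<Longrightarrow> \<phi> x = 0" for x
    using closure_subset[of "{x. \<phi> x \<noteq> 0}"] by (force simp: not_less[symmetric])
  have eq: "partials (rev (mi_list \<beta>)) u = mi_deriv \<beta> u"
    using u(2) by (intro partials_eq_mi_deriv[OF u(1)]) (auto simp: count_list_rev count_list_mi_list)
  have m: "f \<in> borel_measurable lborel" if "continuous_on UNIV f" for f :: "real ^ 'n \<Rightarrow> real"
    using that by (simp add: borel_measurable_continuous_onI)
  have "(\<lambda>x. u x * mi_deriv \<beta> \<phi> x) \<in> borel_measurable lborel"
    using C_class_continuous[OF u(1), of "[]"] mi_deriv_continuous[OF C order_refl, of \<beta>]
    by (intro m continuous_intros) auto
  moreover have "(\<lambda>x. mi_deriv \<beta> u x * \<phi> x) \<in> borel_measurable lborel"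
    using C_class_continuous[OF C, of "[]" 0] mi_deriv_continuous[OF u]
    by (intro m continuous_intros) auto
  ultimately show ?thesis
    using integral_by_parts_iterated[OF u(1), of "mi_list \<beta>" \<phi> R] u(2) C supp
    by (simp add: integral_completion eq) (simp add: mi_deriv_def)
qed

section \<open>Classical derivatives of Sobolev functions are bounded\<close>

text \<open>If \<open>w\<close> exceeded \<open>M\<close> at \<open>a\<close>, it would do so on a ball; testing with a bump function \<open>\<phi>\<close> that is
  positive exactly on this ball would make the integral of \<open>(w - v) * \<phi>\<close> strictly positive.\<close>

lemma continuous_le_of_test_integrals:
  fixes w v :: "real ^ 'n::finite \<Rightarrow> real"
  assumes w: "continuous_on UNIV w" and v: "v \<in> borel_measurable lebesgue"
    and bound: "AE x in lebesgue. \<bar>v x\<bar> \<le> M"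
    and eq: "\<And>\<phi>. \<phi> \<in> test_functions \<Longrightarrow> (LINT x|lebesgue. w x * \<phi> x) = (LINT x|lebesgue. v x * \<phi> x)"
  shows "w a \<le> M"
proof (rule ccontr)
  assume "\<not> w a \<le> M"
  moreover have "open {x. M < w x}"
    using w by (intro open_Collect_less continuous_intros)
  ultimately obtain r where r: "r > 0" "ball a r \<subseteq> {x. M < w x}"
    by (auto simp: open_contains_ball not_le)
  obtain \<phi> where \<phi>: "\<phi> \<in> test_functions" "\<And>x. \<phi> x \<ge> 0" "\<And>x. \<phi> x > 0 \<longleftrightarrow> dist a x < r"
    using exists_bump[OF r(1)] by blast
  have \<phi>c: "continuous_on UNIV \<phi>"
    using \<phi>(1) C_class_continuous[of \<phi> 0 "[]"] by (auto simp: test_functions_def)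
  have \<phi>0: "\<phi> x = 0" if "norm x > norm a + r" for x
  proof -
    have "\<not> dist a x < r"
      using that norm_triangle_sub[of x a] by (simp add: dist_norm norm_minus_commute)
    with \<phi>(2,3)[of x] show ?thesis by simp
  qed
  have "integrable lborel \<phi>" "integrable lborel (\<lambda>x. w x * \<phi> x)"
    by (rule integrable_compact_support[where R = "norm a + r"]; use \<phi>c \<phi>0 w in \<open>auto intro!: continuous_intros\<close>)+
  then have int: "integrable lebesgue \<phi>" "integrable lebesgue (\<lambda>x. w x * \<phi> x)"
    by (auto simp: integrable_completion)
  have intv: "integrable lebesgue (\<lambda>x. v x * \<phi> x)"
  proof (rule Bochner_Integration.integrable_bound)
    show "integrable lebesgue (\<lambda>x. M * \<phi> x)"
      using int by simp
    show "(\<lambda>x. v x * \<phi> x) \<in> borel_measurable lebesgue"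
      using v int by simp
    show "AE x in lebesgue. norm (v x * \<phi> x) \<le> norm (M * \<phi> x)"
      using bound by eventually_elim (auto simp: abs_mult intro!: mult_right_mono)
  qed
  have "(LINT x|lebesgue. (w x - v x) * \<phi> x) = 0"
    using eq[OF \<phi>(1)] int intv by (simp add: left_diff_distrib)
  moreover have pos: "AE x in lebesgue. (w x - v x) * \<phi> x \<ge> 0"
    using bound
  proof eventually_elim
    case (elim x)
    show ?case
    proof (cases "dist a x < r")
      case True
      then have "M < w x" using r(2) by auto
      with elim \<phi>(2)[of x] show ?thesis by simp
    next
      case False
      then have "\<phi> x = 0" using \<phi>(2,3)[of x] by simp
      then show ?thesis by simp
    qed
  qed
  moreover have "integrable lebesgue (\<lambda>x. (w x - v x) * \<phi> x)"
    using int intv by (simp add: left_diff_distrib)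
  ultimately have "AE x in lebesgue. (w x - v x) * \<phi> x = 0"
    using integral_nonneg_eq_0_iff_AE by blast
  then have "AE x in lebesgue. x \<notin> ball a r"
    using bound
  proof eventually_elim
    case (elim x)
    show ?case
    proof
      assume "x \<in> ball a r"
      then have "M < w x" "\<phi> x > 0" using r(2) \<phi>(3) by auto
      with elim show False by simp
    qed
  qed
  then have "negligible (ball a r)"
    by (simp add: negligible_iff_null_sets AE_iff_null_sets)
  then show False
    using open_not_negligible[of "ball a r"] r(1) by auto
qed

lemma Linf_space_imp_AE_bound:
  assumes "v \<in> Linf_space"
  obtains M where "AE x in lebesgue. \<bar>v x\<bar> \<le> M" "esssup lebesgue (\<lambda>x. ereal \<bar>v x\<bar>) = ereal M"
proof -
  let ?s = "esssup lebesgue (\<lambda>x. ereal \<bar>v x\<bar>)"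
  have fin: "?s < \<infinity>" and AE: "AE x in lebesgue. ereal \<bar>v x\<bar> \<le> ?s"
    using assms esssup_AE by (auto simp: Linf_space_def)
  have "?s \<noteq> - \<infinity>"
  proof
    assume "?s = - \<infinity>"
    then have "AE x in (lebesgue :: (real ^ 'a) measure). False"
      using AE by simp
    then have "negligible (UNIV :: (real ^ 'a) set)"
      by (simp add: AE_iff_null_sets[of UNIV, simplified] negligible_iff_null_sets)
    then show False using open_not_negligible by blast
  qed
  with fin obtain M where "?s = ereal M"
    by (cases ?s) auto
  with AE that show ?thesis by auto
qed

lemma abs_le_Linf_norm:
  assumes w: "continuous_on UNIV w" and Linf: "w \<in> Linf_space"
  shows "\<bar>w x\<bar> \<le> Linf_norm w"
proof (rule ccontr)
  obtain M where AE: "AE x in lebesgue. \<bar>w x\<bar> \<le> M" and M: "esssup lebesgue (\<lambda>x. ereal \<bar>w x\<bar>) = ereal M"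
    using Linf_space_imp_AE_bound[OF Linf] by blast
  assume "\<not> ?thesis"
  then have "x \<in> {x. M < \<bar>w x\<bar>}"
    by (simp add: Linf_norm_def M)
  moreover have "open {x. M < \<bar>w x\<bar>}"
    using w by (intro open_Collect_less continuous_intros)
  moreover have "AE x in lebesgue. x \<notin> {x. M < \<bar>w x\<bar>}"
    using AE by eventually_elim simp
  then have "negligible {x. M < \<bar>w x\<bar>}"
    using \<open>open {x. M < \<bar>w x\<bar>}\<close> by (simp add: negligible_iff_null_sets AE_iff_null_sets del: mem_Collect_eq)
  ultimately show False
    using open_not_negligible by blast
qed

text \<open>\<open>Linf_norm\<close> has the default value \<open>0\<close> on essentially unbounded functions, so the claim
  includes that the classical derivative is essentially bounded. The bound comes from the weak
  derivative, with which the classical derivative has all test integrals in common.\<close>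

lemma sobolev_C_class_deriv_bounded:
  fixes u :: "real ^ 'n::finite \<Rightarrow> real"
  assumes u: "u \<in> sobolev_inf N" "u \<in> C_class N" and \<beta>: "mi_deg \<beta> \<le> N"
  shows "\<bar>mi_deriv \<beta> u x\<bar> \<le> Linf_norm (mi_deriv \<beta> u)"
proof (rule abs_le_Linf_norm)
  let ?w = "mi_deriv \<beta> u"
  show w: "continuous_on UNIV ?w"
    by (rule mi_deriv_continuous[OF u(2) \<beta>])
  obtain v where v: "v \<in> Linf_space" "weak_deriv \<beta> u v"
    using u(1) \<beta> by (auto simp: sobolev_inf_def)
  obtain M where M: "AE x in lebesgue. \<bar>v x\<bar> \<le> M"
    using Linf_space_imp_AE_bound[OF v(1)] by blast
  have vm: "v \<in> borel_measurable lebesgue"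
    using v(1) by (simp add: Linf_space_def)
  have eq: "(LINT x|lebesgue. ?w x * \<phi> x) = (LINT x|lebesgue. v x * \<phi> x)" if "\<phi> \<in> test_functions" for \<phi>
    using v(2) integral_mult_mi_deriv[OF u(2) \<beta> that] that by (simp add: weak_deriv_def)
  have "?w y \<le> M" for y
    by (rule continuous_le_of_test_integrals[OF w vm M eq])
  moreover have "- ?w y \<le> M" for y
    by (rule continuous_le_of_test_integrals[where w = "\<lambda>x. - ?w x" and v = "\<lambda>x. - v x"])
       (use w vm M eq in \<open>auto intro: continuous_intros\<close>)
  ultimately have bd: "\<bar>?w y\<bar> \<le> M" for y
    by (simp add: abs_le_iff)
  have meas: "?w \<in> borel_measurable lebesgue"
    using w by (simp add: borel_measurable_continuous_onI measurable_completion)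
  have "esssup lebesgue (\<lambda>x. ereal \<bar>?w x\<bar>) \<le> ereal M"
    using meas bd by (intro esssup_I) auto
  with meas show "?w \<in> Linf_space"
    by (auto simp: Linf_space_def)
qed

section \<open>Estimating the quasi-interpolation error\<close>

lemma mi_deg_mono: "\<alpha> \<le> \<beta> \<Longrightarrow> mi_deg \<alpha> \<le> mi_deg \<beta>"
  unfolding mi_deg_def by (intro sum_mono) (simp add: less_eq_vec_def)

lemma taylor_mi_deriv_remainder_le:
  fixes f :: "real ^ 'n::finite \<Rightarrow> real"
  assumes f: "f \<in> C_class k" and \<gamma>: "mi_deg \<gamma> < k"
    and B: "\<And>\<beta> x. mi_deg \<beta> = k \<Longrightarrow> \<bar>mi_deriv \<beta> f x\<bar> \<le> B \<beta>"
  shows "\<bar>mi_deriv \<gamma> f (x + v) -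
      (\<Sum>\<alpha> | mi_deg \<alpha> < k - mi_deg \<gamma>. mi_power v \<alpha> / mi_fact \<alpha> * mi_deriv (\<gamma> + \<alpha>) f x)\<bar>
    \<le> norm v ^ (k - mi_deg \<gamma>) * (\<Sum>\<beta> | mi_deg \<beta> = k. B \<beta>)"
proof -
  let ?j = "k - mi_deg \<gamma>"
  have B0: "B \<beta> \<ge> 0" if "mi_deg \<beta> = k" for \<beta>
    using B[OF that, of 0] by simp
  obtain t where t: "mi_deriv \<gamma> f (x + v) =
       (\<Sum>\<alpha> | mi_deg \<alpha> < ?j. mi_power v \<alpha> / mi_fact \<alpha> * mi_deriv (\<gamma> + \<alpha>) f x) +
       (\<Sum>\<alpha> | mi_deg \<alpha> = ?j. mi_power v \<alpha> / mi_fact \<alpha> * mi_deriv (\<gamma> + \<alpha>) f (x + t *\<^sub>R v))"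
    using taylor_mi_deriv[OF f \<gamma>] by blast
  have "\<bar>\<Sum>\<alpha> | mi_deg \<alpha> = ?j. mi_power v \<alpha> / mi_fact \<alpha> * mi_deriv (\<gamma> + \<alpha>) f (x + t *\<^sub>R v)\<bar>
      \<le> (\<Sum>\<alpha> | mi_deg \<alpha> = ?j. norm v ^ ?j * B (\<gamma> + \<alpha>))"
  proof (rule sum_abs[THEN order_trans], rule sum_mono)
    fix \<alpha> :: "nat ^ 'n" assume "\<alpha> \<in> {\<alpha>. mi_deg \<alpha> = ?j}"
    then have \<alpha>: "mi_deg \<alpha> = ?j" "mi_deg (\<gamma> + \<alpha>) = k"
      using \<gamma> by (auto simp: mi_deg_add)
    have "\<bar>mi_power v \<alpha>\<bar> / mi_fact \<alpha> \<le> norm v ^ ?j / 1"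
      using abs_mi_power_le[of v \<alpha>] \<alpha>(1) by (intro frac_le mi_fact_ge_1) auto
    then show "\<bar>mi_power v \<alpha> / mi_fact \<alpha> * mi_deriv (\<gamma> + \<alpha>) f (x + t *\<^sub>R v)\<bar> \<le> norm v ^ ?j * B (\<gamma> + \<alpha>)"
      using B[OF \<alpha>(2)] mi_fact_pos[of \<alpha>] unfolding abs_mult abs_divide
      by (intro mult_mono) (simp_all add: abs_of_pos)
  qed
  also have "\<dots> = norm v ^ ?j * (\<Sum>\<beta> \<in> (+) \<gamma> ` {\<alpha>. mi_deg \<alpha> = ?j}. B \<beta>)"
    by (simp add: sum_distrib_left sum.reindex)
  also have "\<dots> \<le> norm v ^ ?j * (\<Sum>\<beta> | mi_deg \<beta> = k. B \<beta>)"
    using \<gamma> B0 by (intro mult_left_mono sum_mono2) (auto simp: mi_deg_add)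
  finally show ?thesis
    by (simp add: t)
qed

text \<open>The coefficient polynomial of \<open>\<partial>\<^sup>\<beta> u x\<close> after Taylor expansion of the quasi-interpolant; its
  integral against \<open>H\<close> is the left-hand side of the moment condition for \<open>\<beta>\<close>.\<close>

definition moment_poly :: "(nat ^ 'n::finite \<Rightarrow> real) \<Rightarrow> nat ^ 'n \<Rightarrow> real ^ 'n \<Rightarrow> real"
  where "moment_poly a \<beta> y = (\<Sum>\<alpha> | \<alpha> \<le> \<beta>. a (\<beta> - \<alpha>) / mi_fact \<alpha> * mi_power y \<alpha>)"

lemma moment_poly_0: "moment_poly a 0 y = a 0"
proof -
  have "{\<alpha> :: nat ^ 'a. \<alpha> \<le> 0} = {0}"
    by (auto simp: less_eq_vec_def vec_eq_iff)
  then show ?thesis by (simp add: moment_poly_def)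
qed

text \<open>Collecting the Taylor polynomials by \<open>\<beta> = \<gamma> + \<alpha>\<close>: the pairs with \<open>|\<gamma>| + |\<alpha>| < N\<close> correspond to
  the pairs \<open>\<alpha> \<le> \<beta>\<close> with \<open>|\<beta>| < N\<close>, and the powers of \<open>- s\<close> combine to \<open>(- s) ^ |\<beta>|\<close>.\<close>

lemma sum_taylor_eq_sum_moment_poly:
  fixes a d :: "nat ^ 'n::finite \<Rightarrow> real"
  shows "(\<Sum>\<gamma> | mi_deg \<gamma> < N. (- s) ^ mi_deg \<gamma> * a \<gamma> *
      (\<Sum>\<alpha> | mi_deg \<alpha> < N - mi_deg \<gamma>. mi_power ((- s) *\<^sub>R y) \<alpha> / mi_fact \<alpha> * d (\<gamma> + \<alpha>)))
    = (\<Sum>\<beta> | mi_deg \<beta> < N. (- s) ^ mi_deg \<beta> * d \<beta> * moment_poly a \<beta> y)"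
proof -
  let ?f = "\<lambda>\<gamma> \<alpha>. (- s) ^ mi_deg \<gamma> * a \<gamma> * (mi_power ((- s) *\<^sub>R y) \<alpha> / mi_fact \<alpha> * d (\<gamma> + \<alpha>))"
  let ?g = "\<lambda>\<beta> \<alpha>. (- s) ^ mi_deg \<beta> * d \<beta> * (a (\<beta> - \<alpha>) / mi_fact \<alpha> * mi_power y \<alpha>)"
  have "(\<Sum>\<gamma> | mi_deg \<gamma> < N. \<Sum>\<alpha> | mi_deg \<alpha> < N - mi_deg \<gamma>. ?f \<gamma> \<alpha>)
      = (\<Sum>(\<gamma>, \<alpha>) \<in> Sigma {\<gamma>. mi_deg \<gamma> < N} (\<lambda>\<gamma>. {\<alpha>. mi_deg \<alpha> < N - mi_deg \<gamma>}). ?f \<gamma> \<alpha>)"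
    by (rule sum.Sigma) auto
  also have "\<dots> = (\<Sum>(\<beta>, \<alpha>) \<in> Sigma {\<beta>. mi_deg \<beta> < N} (\<lambda>\<beta>. {\<alpha>. \<alpha> \<le> \<beta>}). ?g \<beta> \<alpha>)"
  proof (rule sum.reindex_bij_witness[where i = "\<lambda>(\<beta>, \<alpha>). (\<beta> - \<alpha>, \<alpha>)" and j = "\<lambda>(\<gamma>, \<alpha>). (\<gamma> + \<alpha>, \<alpha>)"])
    fix p assume p: "p \<in> Sigma {\<beta> :: nat ^ 'n. mi_deg \<beta> < N} (\<lambda>\<beta>. {\<alpha>. \<alpha> \<le> \<beta>})"
    obtain \<beta> \<alpha> where [simp]: "p = (\<beta>, \<alpha>)" by (cases p)
    have "\<alpha> \<le> \<beta>" "mi_deg \<beta> < N" using p by auto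
    then have eq: "\<beta> - \<alpha> + \<alpha> = \<beta>"
      by (simp add: vec_eq_iff less_eq_vec_def)
    then show "(\<lambda>(\<gamma>, \<alpha>). (\<gamma> + \<alpha>, \<alpha>)) ((\<lambda>(\<beta>, \<alpha>). (\<beta> - \<alpha>, \<alpha>)) p) = p" by simp
    have "mi_deg (\<beta> - \<alpha>) + mi_deg \<alpha> < N"
      using \<open>mi_deg \<beta> < N\<close> by (simp only: mi_deg_add[symmetric] eq)
    then show "(\<lambda>(\<beta>, \<alpha>). (\<beta> - \<alpha>, \<alpha>)) p \<in> Sigma {\<gamma>. mi_deg \<gamma> < N} (\<lambda>\<gamma>. {\<alpha>. mi_deg \<alpha> < N - mi_deg \<gamma>})"
      by auto
  next
    fix p assume p: "p \<in> Sigma {\<gamma> :: nat ^ 'n. mi_deg \<gamma> < N} (\<lambda>\<gamma>. {\<alpha> :: nat ^ 'n. mi_deg \<alpha> < N - mi_deg \<gamma>})"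
    obtain \<gamma> \<alpha> where [simp]: "p = (\<gamma>, \<alpha>)" by (cases p)
    show "(\<lambda>(\<beta>, \<alpha>). (\<beta> - \<alpha>, \<alpha>)) ((\<lambda>(\<gamma>, \<alpha>). (\<gamma> + \<alpha>, \<alpha>)) p) = p" by simp
    show "(\<lambda>(\<gamma>, \<alpha>). (\<gamma> + \<alpha>, \<alpha>)) p \<in> Sigma {\<beta>. mi_deg \<beta> < N} (\<lambda>\<beta>. {\<alpha>. \<alpha> \<le> \<beta>})"
      using p by (auto simp: mi_deg_add less_eq_vec_def)
    show "(case (\<lambda>(\<gamma>, \<alpha>). (\<gamma> + \<alpha>, \<alpha>)) p of (\<beta>, \<alpha>) \<Rightarrow> ?g \<beta> \<alpha>) = (case p of (\<gamma>, \<alpha>) \<Rightarrow> ?f \<gamma> \<alpha>)"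
      by (simp add: mi_power_scaleR mi_deg_add power_add del: scaleR_minus_left)
  qed
  also have "\<dots> = (\<Sum>\<beta> | mi_deg \<beta> < N. \<Sum>\<alpha> | \<alpha> \<le> \<beta>. ?g \<beta> \<alpha>)"
    by (rule sum.Sigma[symmetric]) (auto simp: finite_mi_le)
  finally show ?thesis
    by (simp add: moment_poly_def sum_distrib_left)
qed

lemma power_mult_decay_le:
  fixes y :: "'a::real_normed_vector"
  assumes H: "\<And>y. \<bar>H y\<bar> \<le> C * (1 + norm y) powr (- K)" and j: "j \<le> N"
  shows "norm y ^ j * \<bar>H y\<bar> \<le> C * (1 + norm y) powr (- (K - real N))"
proof -
  have C: "C \<ge> 0"
    using H[of 0] by (auto simp: zero_le_mult_iff)
  have "norm y ^ j \<le> (1 + norm y) ^ j"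
    by (intro power_mono) auto
  also have "\<dots> \<le> (1 + norm y) ^ N"
    by (intro power_increasing j) auto
  also have "\<dots> = (1 + norm y) powr real N"
    by (simp add: powr_realpow add_pos_nonneg)
  finally have "norm y ^ j * \<bar>H y\<bar> \<le> (1 + norm y) powr real N * (C * (1 + norm y) powr (- K))"
    using H[of y] by (intro mult_mono) auto
  also have "\<dots> = C * (1 + norm y) powr (- (K - real N))"
    by (simp add: powr_add[symmetric] mult.left_commute)
  finally show ?thesis .
qed

lemma moment_poly_mult_decay_le:
  fixes y :: "real ^ 'n::finite"
  assumes H: "\<And>y. \<bar>H y\<bar> \<le> C * (1 + norm y) powr (- K)" and \<beta>: "mi_deg \<beta> \<le> N"
  shows "\<bar>moment_poly a \<beta> y * H y\<bar> \<le> (\<Sum>\<alpha> | \<alpha> \<le> \<beta>. \<bar>a (\<beta> - \<alpha>)\<bar>) * C * (1 + norm y) powr (- (K - real N))"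
proof -
  have "\<bar>moment_poly a \<beta> y * H y\<bar> \<le> (\<Sum>\<alpha> | \<alpha> \<le> \<beta>. \<bar>a (\<beta> - \<alpha>) / mi_fact \<alpha> * mi_power y \<alpha> * H y\<bar>)"
    unfolding moment_poly_def sum_distrib_right by (rule sum_abs)
  also have "\<dots> \<le> (\<Sum>\<alpha> | \<alpha> \<le> \<beta>. \<bar>a (\<beta> - \<alpha>)\<bar> * (C * (1 + norm y) powr (- (K - real N))))"
  proof (rule sum_mono)
    fix \<alpha> assume "\<alpha> \<in> {\<alpha>. \<alpha> \<le> \<beta>}"
    then have "mi_deg \<alpha> \<le> N"
      using mi_deg_mono[of \<alpha> \<beta>] \<beta> by simp
    then have *: "\<bar>mi_power y \<alpha>\<bar> * \<bar>H y\<bar> \<le> C * (1 + norm y) powr (- (K - real N))"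
      using power_mult_decay_le[OF H, of "mi_deg \<alpha>" N y] abs_mi_power_le[of y \<alpha>]
      by (meson abs_ge_zero mult_right_mono order_trans)
    have "\<bar>a (\<beta> - \<alpha>)\<bar> / mi_fact \<alpha> \<le> \<bar>a (\<beta> - \<alpha>)\<bar> / 1"
      by (intro divide_left_mono mi_fact_ge_1) auto
    from mult_mono[OF this *]
    show "\<bar>a (\<beta> - \<alpha>) / mi_fact \<alpha> * mi_power y \<alpha> * H y\<bar> \<le> \<bar>a (\<beta> - \<alpha>)\<bar> * (C * (1 + norm y) powr (- (K - real N)))"
      by (simp add: abs_mult mult.assoc less_imp_le[OF mi_fact_pos] abs_of_pos)
  qed
  also have "\<dots> = (\<Sum>\<alpha> | \<alpha> \<le> \<beta>. \<bar>a (\<beta> - \<alpha>)\<bar>) * C * (1 + norm y) powr (- (K - real N))"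
    by (simp add: sum_distrib_right mult.assoc)
  finally show ?thesis .
qed

lemma continuous_on_mi_power: "continuous_on UNIV (\<lambda>y. mi_power y \<alpha>)"
  unfolding mi_power_def by (intro continuous_intros)

lemma continuous_on_moment_poly: "continuous_on UNIV (moment_poly a \<beta>)"
  unfolding moment_poly_def[abs_def] by (intro continuous_intros continuous_on_mi_power)

lemma integral_moment_poly_mult:
  fixes H :: "real ^ 'n::finite \<Rightarrow> real"
  assumes K: "K > real (N + CARD('n))" and H: "\<And>y. \<bar>H y\<bar> \<le> C * (1 + norm y) powr (- K)"
    and cont: "continuous_on UNIV H" and \<beta>: "mi_deg \<beta> \<le> N"
  shows "(LINT y|lborel. moment_poly a \<beta> y * H y) =
    (\<Sum>\<alpha> | \<alpha> \<le> \<beta>. a (\<beta> - \<alpha>) / mi_fact \<alpha> * (LINT y|lebesgue. mi_power y \<alpha> * H y))"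
proof -
  have meas: "(\<lambda>y. mi_power y \<alpha> * H y) \<in> borel_measurable lborel" for \<alpha>
    by (simp add: borel_measurable_continuous_onI continuous_on_mult continuous_on_mi_power cont)
  have int: "integrable lborel (\<lambda>y. mi_power y \<alpha> * H y)" if "\<alpha> \<le> \<beta>" for \<alpha>
  proof (rule Bochner_Integration.integrable_bound[OF _ meas])
    show "integrable lborel (\<lambda>y :: real ^ 'n. C * (1 + norm y) powr (- (K - real N)))"
      using K by (intro integrable_mult_right integrable_decay) simp
    have "\<bar>mi_power y \<alpha> * H y\<bar> \<le> \<bar>C * (1 + norm y) powr (- (K - real N))\<bar>" for y
      using power_mult_decay_le[OF H, of "mi_deg \<alpha>" N y] abs_mi_power_le[of y \<alpha>] mi_deg_mono[OF that] \<beta>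
      unfolding abs_mult[of "mi_power y \<alpha>"]
      by (meson abs_ge_self abs_ge_zero mult_right_mono order_trans)
    then show "AE y in lborel. norm (mi_power y \<alpha> * H y) \<le> norm (C * (1 + norm y) powr (- (K - real N)))"
      by simp
  qed
  have "(LINT y|lborel. moment_poly a \<beta> y * H y) =
      (LINT y|lborel. (\<Sum>\<alpha> | \<alpha> \<le> \<beta>. a (\<beta> - \<alpha>) / mi_fact \<alpha> * (mi_power y \<alpha> * H y)))"
    by (simp add: moment_poly_def sum_distrib_right mult.assoc)
  also have "\<dots> = (\<Sum>\<alpha> | \<alpha> \<le> \<beta>. LINT y|lborel. a (\<beta> - \<alpha>) / mi_fact \<alpha> * (mi_power y \<alpha> * H y))"
    using int by (intro Bochner_Integration.integral_sum integrable_mult_right) auto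
  also have "\<dots> = (\<Sum>\<alpha> | \<alpha> \<le> \<beta>. a (\<beta> - \<alpha>) / mi_fact \<alpha> * (LINT y|lebesgue. mi_power y \<alpha> * H y))"
    using meas by (simp add: integral_completion)
  finally show ?thesis .
qed

lemma has_sum_sum_finite:
  fixes f :: "'i \<Rightarrow> 'b \<Rightarrow> real"
  assumes "finite I" "\<And>i. i \<in> I \<Longrightarrow> (f i has_sum S i) A"
  shows "((\<lambda>x. \<Sum>i\<in>I. f i x) has_sum (\<Sum>i\<in>I. S i)) A"
  using assms by (induction rule: finite_induct) (auto intro!: has_sum_add)

text \<open>The mesh \<open>\<delta> = 1 / sqrt D\<close> is fixed here, and the Riemann sums
  enter only through their deviation \<open>\<epsilon>\<close> from the moments and through the bound \<open>J\<close> for the sums of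
  the decaying weight. The Taylor polynomial part and the remainder are summable separately; this
  is what makes the infinite sum in the quasi-interpolant meaningful, although the derivatives of
  \<open>u\<close> of lower order are controlled only by Taylor's formula.\<close>

lemma quasi_interp_error_le:
  fixes a :: "nat ^ 'n::finite \<Rightarrow> real" and H u :: "real ^ 'n \<Rightarrow> real"
  assumes N: "N \<ge> 1" and h: "h > 0" and \<delta>: "\<delta> > 0" and D: "D = 1 / \<delta>\<^sup>2"
    and K: "K > real (N + CARD('n))" and H: "\<And>y. \<bar>H y\<bar> \<le> C * (1 + norm y) powr (- K)"
    and u: "u \<in> C_class N" and B: "\<And>\<beta> x. mi_deg \<beta> = N \<Longrightarrow> \<bar>mi_deriv \<beta> u x\<bar> \<le> B \<beta>"
    and main: "\<And>\<beta> z. mi_deg \<beta> < N \<Longrightarrow>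
      \<bar>\<delta> ^ CARD('n) * (\<Sum>\<^sub>\<infinity>m\<in>UNIV. moment_poly a \<beta> (z - lattice_pt \<delta> m) * H (z - lattice_pt \<delta> m)) - of_bool (\<beta> = 0)\<bar> \<le> \<epsilon>"
    and tail: "\<And>z :: real ^ 'n. \<delta> ^ CARD('n) * (\<Sum>\<^sub>\<infinity>m\<in>UNIV. (1 + norm (z - lattice_pt \<delta> m)) powr (- (K - real N))) \<le> J"
  shows "\<bar>quasi_interp N a H D h u x - u x\<bar>
      \<le> \<epsilon> * (\<Sum>\<beta> | mi_deg \<beta> < N. (h * sqrt D) ^ mi_deg \<beta> * \<bar>mi_deriv \<beta> u x\<bar>)
        + (\<Sum>\<gamma> | mi_deg \<gamma> < N. \<bar>a \<gamma>\<bar>) * C * J * (h * sqrt D) ^ N * (\<Sum>\<beta> | mi_deg \<beta> = N. B \<beta>)"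
proof -
  define s where "s = h * sqrt D"
  define z where "z = x /\<^sub>R s"
  define y where "y m = z - lattice_pt \<delta> m" for m :: "int ^ 'n"
  define g where "g = (\<Sum>\<beta> | mi_deg \<beta> = N. B \<beta>)"
  define A where "A = (\<Sum>\<gamma> | mi_deg \<gamma> < N. \<bar>a \<gamma>\<bar>)"
  define p where "p = K - real N"
  define d where "d \<beta> = mi_deriv \<beta> u x" for \<beta>
  define summand where "summand m = (\<Sum>\<gamma> | mi_deg \<gamma> < N. (- s) ^ mi_deg \<gamma> * a \<gamma> * mi_deriv \<gamma> u (lattice_pt h m)) * H (y m)" for m
  define G where "G \<beta> m = moment_poly a \<beta> (y m) * H (y m)" for \<beta> m
  define E where "E m = summand m - (\<Sum>\<beta> | mi_deg \<beta> < N. (- s) ^ mi_deg \<beta> * d \<beta> * G \<beta> m)" for m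
  have sqrtD: "sqrt D = 1 / \<delta>"
    using \<delta> by (simp add: D real_sqrt_divide)
  then have s: "s > 0" "s * \<delta> = h"
    using \<delta> h by (auto simp: s_def)
  have p: "p > real CARD('n)"
    using K by (simp add: p_def)
  have C: "C \<ge> 0"
    using H[of 0] by simp
  have g: "g \<ge> 0"
    unfolding g_def using B[of _ 0] by (intro sum_nonneg) (force intro: order_trans[OF abs_ge_zero])
  have lt: "{\<gamma> :: nat ^ 'n. mi_deg \<gamma> \<le> N - 1} = {\<gamma>. mi_deg \<gamma> < N}"
    using N by auto
  have pt: "lattice_pt h m = x + (- s) *\<^sub>R y m" for m
    using s by (simp add: vec_eq_iff y_def z_def lattice_pt_def field_simps)
  then have arg: "(x - lattice_pt h m) /\<^sub>R s = y m" for m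
    using s by simp
  have vol: "D powr (- real CARD('n) / 2) = \<delta> ^ CARD('n)"
  proof -
    have "D = \<delta> powr (- 2)"
      using \<delta> by (simp add: D powr_minus_divide powr_numeral)
    then have "D powr (- real CARD('n) / 2) = \<delta> powr real CARD('n)"
      by (simp add: powr_powr)
    then show ?thesis
      using \<delta> by (simp add: powr_realpow)
  qed
  have M: "quasi_interp N a H D h u x = \<delta> ^ CARD('n) * (\<Sum>\<^sub>\<infinity>m\<in>UNIV. summand m)"
    unfolding quasi_interp_def vol lt s_def[symmetric] arg summand_def
    by (simp add: s_def)
  have E_le: "\<bar>E m\<bar> \<le> A * C * s ^ N * g * (1 + norm (y m)) powr (- p)" for m
  proof -
    define T where "T \<gamma> = (\<Sum>\<alpha> | mi_deg \<alpha> < N - mi_deg \<gamma>. mi_power ((- s) *\<^sub>R y m) \<alpha> / mi_fact \<alpha> * d (\<gamma> + \<alpha>))" for \<gamma>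
    have "(\<Sum>\<beta> | mi_deg \<beta> < N. (- s) ^ mi_deg \<beta> * d \<beta> * G \<beta> m) =
        (\<Sum>\<gamma> | mi_deg \<gamma> < N. (- s) ^ mi_deg \<gamma> * a \<gamma> * T \<gamma>) * H (y m)"
      unfolding T_def sum_taylor_eq_sum_moment_poly by (simp add: G_def sum_distrib_right mult.assoc)
    then have "E m = (\<Sum>\<gamma> | mi_deg \<gamma> < N. (- s) ^ mi_deg \<gamma> * a \<gamma> * (mi_deriv \<gamma> u (lattice_pt h m) - T \<gamma>) * H (y m))"
      by (simp only: E_def summand_def sum_distrib_right sum_subtractf[symmetric]
          left_diff_distrib[symmetric] right_diff_distrib[symmetric])
    also have "\<bar>\<dots>\<bar> \<le> (\<Sum>\<gamma> | mi_deg \<gamma> < N. \<bar>a \<gamma>\<bar> * (C * s ^ N * g * (1 + norm (y m)) powr (- p)))"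
    proof (rule sum_abs[THEN order_trans], rule sum_mono)
      fix \<gamma> :: "nat ^ 'n" assume "\<gamma> \<in> {\<gamma>. mi_deg \<gamma> < N}"
      then have \<gamma>: "mi_deg \<gamma> < N" by simp
      have "\<bar>mi_deriv \<gamma> u (lattice_pt h m) - T \<gamma>\<bar> \<le> norm ((- s) *\<^sub>R y m) ^ (N - mi_deg \<gamma>) * g"
        unfolding T_def d_def pt g_def by (rule taylor_mi_deriv_remainder_le[OF u \<gamma> B])
      also have "\<dots> = s ^ (N - mi_deg \<gamma>) * norm (y m) ^ (N - mi_deg \<gamma>) * g"
        using s by (simp add: power_mult_distrib)
      finally have R: "\<bar>mi_deriv \<gamma> u (lattice_pt h m) - T \<gamma>\<bar> \<le> \<dots>" .
      have "\<bar>(- s) ^ mi_deg \<gamma> * a \<gamma> * (mi_deriv \<gamma> u (lattice_pt h m) - T \<gamma>) * H (y m)\<bar>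
          = s ^ mi_deg \<gamma> * \<bar>a \<gamma>\<bar> * \<bar>mi_deriv \<gamma> u (lattice_pt h m) - T \<gamma>\<bar> * \<bar>H (y m)\<bar>"
        using s by (simp add: abs_mult power_abs)
      also have "\<dots> \<le> s ^ mi_deg \<gamma> * \<bar>a \<gamma>\<bar> * (s ^ (N - mi_deg \<gamma>) * norm (y m) ^ (N - mi_deg \<gamma>) * g) * \<bar>H (y m)\<bar>"
        using s R by (intro mult_right_mono mult_left_mono) auto
      also have "\<dots> = \<bar>a \<gamma>\<bar> * (s ^ mi_deg \<gamma> * s ^ (N - mi_deg \<gamma>)) * g * (norm (y m) ^ (N - mi_deg \<gamma>) * \<bar>H (y m)\<bar>)"
        by (simp add: mult_ac)
      also have "s ^ mi_deg \<gamma> * s ^ (N - mi_deg \<gamma>) = s ^ N"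
        using \<gamma> by (simp add: power_add[symmetric])
      also have "\<bar>a \<gamma>\<bar> * s ^ N * g * (norm (y m) ^ (N - mi_deg \<gamma>) * \<bar>H (y m)\<bar>)
          \<le> \<bar>a \<gamma>\<bar> * s ^ N * g * (C * (1 + norm (y m)) powr (- p))"
        unfolding p_def using s g by (intro mult_left_mono power_mult_decay_le[OF H]) auto
      finally show "\<bar>(- s) ^ mi_deg \<gamma> * a \<gamma> * (mi_deriv \<gamma> u (lattice_pt h m) - T \<gamma>) * H (y m)\<bar>
          \<le> \<bar>a \<gamma>\<bar> * (C * s ^ N * g * (1 + norm (y m)) powr (- p))"
        by (simp add: mult_ac)
    qed
    also have "\<dots> = A * C * s ^ N * g * (1 + norm (y m)) powr (- p)"
      by (simp add: A_def sum_distrib_right mult.assoc)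
    finally show ?thesis .
  qed
  have sumG: "G \<beta> summable_on UNIV" if "mi_deg \<beta> < N" for \<beta>
    unfolding G_def y_def
    by (rule decay_lattice_summable[OF \<delta> p moment_poly_mult_decay_le[OF H, of _ N, folded p_def]])
       (use that in simp)
  have sumw: "(\<lambda>m. (1 + norm (y m)) powr (- p)) summable_on UNIV"
    unfolding y_def by (rule decay_lattice_summable[OF \<delta> p, where A = 1]) simp
  have sumE': "(\<lambda>m. A * C * s ^ N * g * (1 + norm (y m)) powr (- p)) summable_on UNIV"
    by (intro summable_on_cmult_right sumw)
  then have sumEabs: "(\<lambda>m. norm (E m)) summable_on UNIV"
    by (rule summable_on_comparison_test) (use E_le in auto)
  then have sumE: "E summable_on UNIV"
    by (rule abs_summable_summable)
  have "\<bar>\<Sum>\<^sub>\<infinity>m\<in>UNIV. E m\<bar> \<le> (\<Sum>\<^sub>\<infinity>m\<in>UNIV. norm (E m))"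
    using norm_infsum_bound[OF sumEabs] by simp
  also have "\<dots> \<le> (\<Sum>\<^sub>\<infinity>m\<in>UNIV. A * C * s ^ N * g * (1 + norm (y m)) powr (- p))"
    using E_le by (intro infsum_mono sumEabs sumE') auto
  also have "\<dots> = A * C * s ^ N * g * (\<Sum>\<^sub>\<infinity>m\<in>UNIV. (1 + norm (y m)) powr (- p))"
    by (intro infsum_cmult_right sumw)
  finally have "\<delta> ^ CARD('n) * \<bar>\<Sum>\<^sub>\<infinity>m\<in>UNIV. E m\<bar> \<le>
      A * C * s ^ N * g * (\<delta> ^ CARD('n) * (\<Sum>\<^sub>\<infinity>m\<in>UNIV. (1 + norm (y m)) powr (- p)))"
    using \<delta> by (simp add: mult.left_commute mult_left_mono)
  also have "\<dots> \<le> A * C * s ^ N * g * J"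
    using tail[of z, folded y_def p_def] C g s
    by (intro mult_left_mono mult_nonneg_nonneg) (auto simp: A_def intro: sum_nonneg)
  finally have E_total: "\<bar>\<delta> ^ CARD('n) * (\<Sum>\<^sub>\<infinity>m\<in>UNIV. E m)\<bar> \<le> A * C * s ^ N * g * J"
    using \<delta> by (simp add: abs_mult)
  have "((\<lambda>m. \<Sum>\<beta> | mi_deg \<beta> < N. (- s) ^ mi_deg \<beta> * d \<beta> * G \<beta> m) has_sum
      (\<Sum>\<beta> | mi_deg \<beta> < N. (- s) ^ mi_deg \<beta> * d \<beta> * (\<Sum>\<^sub>\<infinity>m\<in>UNIV. G \<beta> m))) UNIV"
    using sumG by (intro has_sum_sum_finite has_sum_cmult_right has_sum_infsum) auto
  from has_sum_add[OF this has_sum_infsum[OF sumE]]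
  have "(\<Sum>\<^sub>\<infinity>m\<in>UNIV. summand m) = (\<Sum>\<beta> | mi_deg \<beta> < N. (- s) ^ mi_deg \<beta> * d \<beta> * (\<Sum>\<^sub>\<infinity>m\<in>UNIV. G \<beta> m)) + (\<Sum>\<^sub>\<infinity>m\<in>UNIV. E m)"
    by (intro infsumI) (simp add: E_def[abs_def])
  moreover have "u x = (\<Sum>\<beta> | mi_deg \<beta> < N. (- s) ^ mi_deg \<beta> * d \<beta> * of_bool (\<beta> = 0))"
  proof -
    have "(\<Sum>\<beta> | mi_deg \<beta> < N. (- s) ^ mi_deg \<beta> * d \<beta> * of_bool (\<beta> = 0)) =
        (\<Sum>\<beta> | mi_deg \<beta> < N. if \<beta> = 0 then d \<beta> else 0)"
      by (intro sum.cong) auto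
    then show ?thesis using N by (simp add: d_def)
  qed
  ultimately have "quasi_interp N a H D h u x - u x =
      (\<Sum>\<beta> | mi_deg \<beta> < N. (- s) ^ mi_deg \<beta> * d \<beta> * (\<delta> ^ CARD('n) * (\<Sum>\<^sub>\<infinity>m\<in>UNIV. G \<beta> m) - of_bool (\<beta> = 0)))
      + \<delta> ^ CARD('n) * (\<Sum>\<^sub>\<infinity>m\<in>UNIV. E m)"
    unfolding M by (simp add: sum_subtractf distrib_left right_diff_distrib sum_distrib_left mult_ac)
  also have "\<bar>\<dots>\<bar> \<le>
      \<bar>\<Sum>\<beta> | mi_deg \<beta> < N. (- s) ^ mi_deg \<beta> * d \<beta> * (\<delta> ^ CARD('n) * (\<Sum>\<^sub>\<infinity>m\<in>UNIV. G \<beta> m) - of_bool (\<beta> = 0))\<bar>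
      + \<bar>\<delta> ^ CARD('n) * (\<Sum>\<^sub>\<infinity>m\<in>UNIV. E m)\<bar>"
    by (rule abs_triangle_ineq)
  also have "\<bar>\<Sum>\<beta> | mi_deg \<beta> < N. (- s) ^ mi_deg \<beta> * d \<beta> * (\<delta> ^ CARD('n) * (\<Sum>\<^sub>\<infinity>m\<in>UNIV. G \<beta> m) - of_bool (\<beta> = 0))\<bar>
      \<le> (\<Sum>\<beta> | mi_deg \<beta> < N. s ^ mi_deg \<beta> * \<bar>d \<beta>\<bar> * \<epsilon>)"
  proof (rule sum_abs[THEN order_trans], rule sum_mono)
    fix \<beta> :: "nat ^ 'n" assume "\<beta> \<in> {\<beta>. mi_deg \<beta> < N}"
    then have "\<bar>\<delta> ^ CARD('n) * (\<Sum>\<^sub>\<infinity>m\<in>UNIV. G \<beta> m) - of_bool (\<beta> = 0)\<bar> \<le> \<epsilon>"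
      unfolding G_def y_def by (intro main) simp
    then show "\<bar>(- s) ^ mi_deg \<beta> * d \<beta> * (\<delta> ^ CARD('n) * (\<Sum>\<^sub>\<infinity>m\<in>UNIV. G \<beta> m) - of_bool (\<beta> = 0))\<bar> \<le> s ^ mi_deg \<beta> * \<bar>d \<beta>\<bar> * \<epsilon>"
      unfolding abs_mult power_abs using s by (simp add: mult_left_mono)
  qed
  also note E_total
  finally show ?thesis
    by (simp add: s_def g_def A_def d_def sum_distrib_left mult_ac)
qed

theorem theorem2p1:
  fixes N n\<^sub>0 :: nat
    and a :: "nat ^ 'n::finite \<Rightarrow> real"
    and H :: "real ^ 'n \<Rightarrow> real"
  assumes N: "N \<ge> 1"
    and a0: "a 0 = 1"
    and n0: "n\<^sub>0 = (LEAST k. real k > real CARD('n) / 2)"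
    and H_diff: "times_differentiable n\<^sub>0 H"
    and H_decay: "\<exists>K > real (N + CARD('n)). \<exists>C :: nat ^ 'n \<Rightarrow> real.
      \<forall>\<beta>. mi_deg \<beta> \<le> n\<^sub>0 \<longrightarrow>
        C \<beta> > 0 \<and> (\<forall>x. \<bar>mi_deriv \<beta> H x\<bar> \<le> C \<beta> * (1 + norm x) powr (- K))"
    and H_int: "(LINT x|lebesgue. H x) = 1"
    and H_moments: "\<And>\<beta>. 1 \<le> mi_deg \<beta> \<Longrightarrow> mi_deg \<beta> \<le> N - 1 \<Longrightarrow>
      (\<Sum>\<alpha> | \<alpha> \<le> \<beta>. a (\<beta> - \<alpha>) / mi_fact \<alpha> * (LINT x|lebesgue. mi_power x \<alpha> * H x)) = 0"
  shows "\<exists>c :: real. \<forall>\<epsilon> > 0. \<exists>D > 0. \<forall>h > 0. \<forall>u \<in> sobolev_inf N \<inter> C_class N. \<forall>x.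
    \<bar>quasi_interp N a H D h u x - u x\<bar>
      \<le> \<epsilon> * (\<Sum>\<beta> | mi_deg \<beta> \<le> N - 1. (h * sqrt D) ^ mi_deg \<beta> * \<bar>mi_deriv \<beta> u x\<bar>)
        + c * (h * sqrt D) ^ N * grad_norm N u"
proof -
  obtain K and C' :: "nat ^ 'n \<Rightarrow> real" where K: "K > real (N + CARD('n))"
    and C': "\<And>\<beta> x. mi_deg \<beta> \<le> n\<^sub>0 \<Longrightarrow> \<bar>mi_deriv \<beta> H x\<bar> \<le> C' \<beta> * (1 + norm x) powr (- K)"
    using H_decay by blast
  define C where "C = C' 0"
  have H: "\<bar>H y\<bar> \<le> C * (1 + norm y) powr (- K)" for y
    using C'[of 0 y] by (simp add: C_def)
  \<comment> \<open>Riemann sums need continuity of \<open>H\<close>, which follows from \<open>n\<^sub>0 \<ge> 1\<close>.\<close>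
  have "n\<^sub>0 \<noteq> 0"
  proof -
    obtain k :: nat where "real CARD('n) / 2 < real k"
      using reals_Archimedean2 by blast
    then have "real n\<^sub>0 > real CARD('n) / 2"
      unfolding n0 by (rule LeastI)
    then show ?thesis by auto
  qed
  then have "H differentiable at x" for x
    using H_diff by (auto simp: times_differentiable_def dest: spec[of _ "[]"])
  then have cont: "continuous_on UNIV H"
    by (auto simp: continuous_on_eq_continuous_at intro: differentiable_imp_continuous_within)
  have moments: "(LINT y|lborel. moment_poly a \<beta> y * H y) = of_bool (\<beta> = 0)" if "mi_deg \<beta> < N" for \<beta>
  proof (cases "\<beta> = 0")
    case True
    have "(LINT y|lborel. H y) = 1"
      using H_int cont by (simp add: integral_completion borel_measurable_continuous_onI)
    with True show ?thesis by (simp add: moment_poly_0 a0)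
  next
    case False
    then have "1 \<le> mi_deg \<beta>" "mi_deg \<beta> \<le> N - 1"
      using that by (auto simp: Suc_le_eq simp flip: neq0_conv)
    from H_moments[OF this] False that show ?thesis
      by (subst integral_moment_poly_mult[OF K H cont]) simp_all
  qed
  define p where "p = K - real N"
  have p: "p > real CARD('n)"
    using K by (simp add: p_def)
  \<comment> \<open>Once the mesh is fine enough, the sums of the weight are within \<open>1\<close> of its integral. The
    bound \<open>J\<close> is chosen before \<open>\<epsilon>\<close> and \<open>D\<close>, so the constant depends on neither.\<close>
  define J where "J = (LINT y|lborel. (1 + norm (y :: real ^ 'n)) powr (- p)) + 1"
  show ?thesis
  proof (rule exI[of _ "(\<Sum>\<gamma> | mi_deg \<gamma> < N. \<bar>a \<gamma>\<bar>) * C * J"], intro allI impI)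
    fix \<epsilon> :: real assume \<epsilon>: "\<epsilon> > 0"
    have "\<forall>\<^sub>F \<delta> in at_right 0. \<forall>z.
      \<bar>\<delta> ^ CARD('n) * (\<Sum>\<^sub>\<infinity>m\<in>UNIV. moment_poly a \<beta> (z - lattice_pt \<delta> m) * H (z - lattice_pt \<delta> m)) - of_bool (\<beta> = 0)\<bar> < \<epsilon>"
      if "mi_deg \<beta> < N" for \<beta>
      unfolding moments[OF that, symmetric]
      by (rule lattice_riemann_sums_uniform[OF p _ moment_poly_mult_decay_le[OF H, of \<beta> N, folded p_def] \<epsilon>])
         (use that in \<open>auto intro!: continuous_intros continuous_on_moment_poly cont\<close>)
    then have "\<forall>\<^sub>F \<delta> in at_right 0. \<forall>\<beta>\<in>{\<beta>. mi_deg \<beta> < N}. \<forall>z.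
      \<bar>\<delta> ^ CARD('n) * (\<Sum>\<^sub>\<infinity>m\<in>UNIV. moment_poly a \<beta> (z - lattice_pt \<delta> m) * H (z - lattice_pt \<delta> m)) - of_bool (\<beta> = 0)\<bar> < \<epsilon>"
      by (intro eventually_ball_finite) auto
    moreover have "\<forall>\<^sub>F \<delta> in at_right 0. \<forall>z :: real ^ 'n.
      \<bar>\<delta> ^ CARD('n) * (\<Sum>\<^sub>\<infinity>m\<in>UNIV. (1 + norm (z - lattice_pt \<delta> m)) powr (- p)) - (J - 1)\<bar> < 1"
      unfolding J_def add_diff_cancel_right'
      by (rule lattice_riemann_sums_uniform[where A = 1, OF p])
         (auto intro!: continuous_intros simp: add_pos_nonneg add_nonneg_eq_0_iff)
    moreover have "\<forall>\<^sub>F \<delta> in at_right (0 :: real). \<delta> > 0"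
      by (rule eventually_at_right_less)
    ultimately have "\<forall>\<^sub>F \<delta> in at_right 0. \<delta> > 0 \<and>
      (\<forall>\<beta>\<in>{\<beta>. mi_deg \<beta> < N}. \<forall>z. \<bar>\<delta> ^ CARD('n) * (\<Sum>\<^sub>\<infinity>m\<in>UNIV. moment_poly a \<beta> (z - lattice_pt \<delta> m) * H (z - lattice_pt \<delta> m)) - of_bool (\<beta> = 0)\<bar> < \<epsilon>) \<and>
      (\<forall>z :: real ^ 'n. \<bar>\<delta> ^ CARD('n) * (\<Sum>\<^sub>\<infinity>m\<in>UNIV. (1 + norm (z - lattice_pt \<delta> m)) powr (- p)) - (J - 1)\<bar> < 1)"
      by eventually_elim blast
    then obtain \<delta> where \<delta>: "\<delta> > 0" and
      main: "\<And>\<beta> z. mi_deg \<beta> < N \<Longrightarrow> \<bar>\<delta> ^ CARD('n) * (\<Sum>\<^sub>\<infinity>m\<in>UNIV. moment_poly a \<beta> (z - lattice_pt \<delta> m) * H (z - lattice_pt \<delta> m)) - of_bool (\<beta> = 0)\<bar> < \<epsilon>" and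
      tail: "\<And>z :: real ^ 'n. \<bar>\<delta> ^ CARD('n) * (\<Sum>\<^sub>\<infinity>m\<in>UNIV. (1 + norm (z - lattice_pt \<delta> m)) powr (- p)) - (J - 1)\<bar> < 1"
      using eventually_happens'[OF trivial_limit_at_right_real] by blast
    show "\<exists>D > 0. \<forall>h > 0. \<forall>u \<in> sobolev_inf N \<inter> C_class N. \<forall>x.
      \<bar>quasi_interp N a H D h u x - u x\<bar>
      \<le> \<epsilon> * (\<Sum>\<beta> | mi_deg \<beta> \<le> N - 1. (h * sqrt D) ^ mi_deg \<beta> * \<bar>mi_deriv \<beta> u x\<bar>)
        + (\<Sum>\<gamma> | mi_deg \<gamma> < N. \<bar>a \<gamma>\<bar>) * C * J * (h * sqrt D) ^ N * grad_norm N u"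
    proof (intro exI[of _ "1 / \<delta>\<^sup>2"] conjI allI impI ballI)
      show "1 / \<delta>\<^sup>2 > 0" using \<delta> by simp
      fix h :: real and u :: "real ^ 'n \<Rightarrow> real" and x :: "real ^ 'n"
      assume h: "h > 0" and u: "u \<in> sobolev_inf N \<inter> C_class N"
      have lt: "{\<gamma> :: nat ^ 'n. mi_deg \<gamma> \<le> N - 1} = {\<gamma>. mi_deg \<gamma> < N}"
        using N by auto
      show "\<bar>quasi_interp N a H (1 / \<delta>\<^sup>2) h u x - u x\<bar>
        \<le> \<epsilon> * (\<Sum>\<beta> | mi_deg \<beta> \<le> N - 1. (h * sqrt (1 / \<delta>\<^sup>2)) ^ mi_deg \<beta> * \<bar>mi_deriv \<beta> u x\<bar>)
          + (\<Sum>\<gamma> | mi_deg \<gamma> < N. \<bar>a \<gamma>\<bar>) * C * J * (h * sqrt (1 / \<delta>\<^sup>2)) ^ N * grad_norm N u"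
        unfolding lt grad_norm_def
      proof (rule quasi_interp_error_le[OF N h \<delta> refl K H])
        show "u \<in> C_class N" using u by simp
        show "\<bar>mi_deriv \<beta> u y\<bar> \<le> Linf_norm (mi_deriv \<beta> u)" if "mi_deg \<beta> = N" for \<beta> y
          using u that by (intro sobolev_C_class_deriv_bounded) auto
        show "\<bar>\<delta> ^ CARD('n) * (\<Sum>\<^sub>\<infinity>m\<in>UNIV. moment_poly a \<beta> (z - lattice_pt \<delta> m) * H (z - lattice_pt \<delta> m)) - of_bool (\<beta> = 0)\<bar> \<le> \<epsilon>"
          if "mi_deg \<beta> < N" for \<beta> z
          using main[OF that, of z] by simp
        show "\<delta> ^ CARD('n) * (\<Sum>\<^sub>\<infinity>m\<in>UNIV. (1 + norm (z - lattice_pt \<delta> m)) powr (- (K - real N))) \<le> J" for z :: "real ^ 'n"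
          using tail[of z] by (simp add: p_def abs_less_iff)
      qed
    qed
  qed
qed

end
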